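(* Let $\Bbbk$ be a field, $R=\Bbbk[x_1,\dots,x_n]$, $\tau$ a term order on $R$, $F$ a finite list of nonzero elements of $R$, and $\mathrm{Sel}$ a selection function, i.e. a function assigning to each list $\ell$ of critical pairs a sublist $\mathrm{Sel}(\ell)$ of $\ell$, with $\mathrm{Sel}(\ell)\neq\emptyset$ whenever $\ell\ne\emptyset$. Then the algorithm F4 (described in the context) with input $F,\mathrm{Sel},\tau$ terminates and returns a finite list $G\subseteq R$ that is a Gröbner basis of the ideal $(F)$ with respect to $\tau$, and such that $F\subseteq G$ and $(F)=(G)$.
   Context: A term is a monic monomial; $\mathbb T$ is the set of terms of $R$. A term order is a total order on $\mathbb T$ compatible with multiplication for which $m_1\mid m_2$ implies $m_1\le m_2$. For $f\ne0$: $\mathrm{Supp}(f)$ is the set of terms with nonzero coefficient in $f$; $\mathrm{LT}(f)=\max_\tau\mathrm{Supp}(f)$; $\mathrm{LC}(f)$ is its coefficient; $\mathrm{LM}(f)=\mathrm{LC}(f)\mathrm{LT}(f)$. For a list $F$ of polynomials, $\mathrm{Supp}(F)$ is the union of the supports and $\mathrm{LT}(F)$ the set of leading terms of its nonzero elements. A Gröbner basis of an ideal $I$ is a finite subset of $I$ whose leading terms generate the ideal generated by all leading terms of nonzero elements of $I$. $S$-half: $\mathrm{s\_half}(f,g)=\frac{\mathrm{LM}(g)}{\gcd(\mathrm{LT}(f),\mathrm{LT}(g))}f$. Critical pair: $\mathrm{Pair}(f,g)=(\mathrm{lcm}(\mathrm{LT}(f),\mathrm{LT}(g)),\mathrm{s\_half}(f,g),\mathrm{s\_half}(g,f))$.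 RREF of a list $F$ of polynomials: write $\mathrm{Supp}(F)=\{t_1>_\tau\dots>_\tau t_s\}$, let $\mathrm{matrix}(F)$ be the matrix whose $(i,j)$ entry is the coefficient of $t_j$ in the $i$-th polynomial; the RREF $\widetilde F$ of $F$ is the list of polynomials given by the nonzero rows of the reduced row echelon form of $\mathrm{matrix}(F)$. symPre$(L,G)$: set $F:=L$, $\mathrm{Done}:=\mathrm{LT}(F)$. While $\mathrm{Supp}(F)\ne\mathrm{Done}$: select any $t\in\mathrm{Supp}(F)\setminus\mathrm{Done}$ and add $t$ to $\mathrm{Done}$; if there exist $g\in G$ and $t'\in\mathbb T$ with $t=t'\,\mathrm{LT}(g)$, choose such a $g$ and $t'$ and append $t'g$ to $F$. Return $F$. Red$(L,G)$: let $F=\mathrm{symPre}(L,G)$ and $\widetilde F$ its RREF; return $\widetilde F^+=[f\in\widetilde F\mid \mathrm{LT}(f)\notin\mathrm{LT}(F)]$. F4$(F,\mathrm{Sel},\tau)$: set $G:=F$, $d:=0$, and let $P$ be the list of all $\mathrm{Pair}(f,g)$ with $f,g\in G$, $f\ne g$ (one for each unordered pair). While $P\neq\emptyset$: $d:=d+1$; $P_d:=\mathrm{Sel}(P)$; $P:=P\setminus P_d$; $L_d:=[\mathrm{s\_half}(f,g),\mathrm{s\_half}(g,f)\mid \mathrm{Pair}(f,g)\in P_d]$; $\widetilde F_d^+:=\mathrm{Red}(L_d,G)$; for each $h\in\widetilde F_d^+$: $P:=P\cup[\mathrm{Pair}(h,g)\mid g\in G]$ and then $G:=G\cup[h]$.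 Return $G$. *)

theory Defs
  imports
    "HOL-Library.Poly_Mapping"
    "HOL-Library.Sublist"
    "Jordan_Normal_Form.Gauss_Jordan_Elimination"
begin

section \<open>Terms, polynomials and term orders\<close>

text \<open>Terms are exponent vectors, so the product of terms is addition of exponents, a quotient of
  terms is subtraction, and divisibility is the pointwise order. The variables are indexed by a
  finite type.\<close>

type_synonym 'n trm = "'n \<Rightarrow>\<^sub>0 nat"
type_synonym ('n, 'k) mpoly = "'n trm \<Rightarrow>\<^sub>0 'k"

lift_definition trm_gcd :: "'n trm \<Rightarrow> 'n trm \<Rightarrow> 'n trm"
  is "\<lambda>s t i. min (s i) (t i)"
  by (auto elim: finite_subset[rotated])

lift_definition trm_lcm :: "'n trm \<Rightarrow> 'n trm \<Rightarrow> 'n trm"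
  is "\<lambda>s t i. max (s i) (t i)"
  by (simp add: less_max_iff_disj Collect_disj_eq)

text \<open>A term order is given by its reflexive relation: \<open>\<tau> s t\<close> means \<open>s \<le> t\<close>.\<close>

definition term_order :: "('n trm \<Rightarrow> 'n trm \<Rightarrow> bool) \<Rightarrow> bool" where
  "term_order \<tau> \<longleftrightarrow>
     class.linorder \<tau> (\<lambda>s t. \<tau> s t \<and> \<not> \<tau> t s) \<and>
     (\<forall>s t u. \<tau> s t \<longrightarrow> \<tau> (s + u) (t + u)) \<and>
     (\<forall>s t. (\<exists>u. t = s + u) \<longrightarrow> \<tau> s t)"

definition Supp :: "('n, 'k::zero) mpoly list \<Rightarrow> 'n trm set" where
  "Supp F = (\<Union>f\<in>set F. Poly_Mapping.keys f)"

text \<open>\<open>LT\<close>, \<open>LC\<close> and \<open>LM\<close> are meaningful for nonzero polynomials only.\<close>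

definition LT :: "('n trm \<Rightarrow> 'n trm \<Rightarrow> bool) \<Rightarrow> ('n, 'k::zero) mpoly \<Rightarrow> 'n trm" where
  "LT \<tau> f = (THE t. t \<in> Poly_Mapping.keys f \<and> (\<forall>s\<in>Poly_Mapping.keys f. \<tau> s t))"

definition LC :: "('n trm \<Rightarrow> 'n trm \<Rightarrow> bool) \<Rightarrow> ('n, 'k::zero) mpoly \<Rightarrow> 'k" where
  "LC \<tau> f = Poly_Mapping.lookup f (LT \<tau> f)"

definition LM :: "('n trm \<Rightarrow> 'n trm \<Rightarrow> bool) \<Rightarrow> ('n, 'k::zero) mpoly \<Rightarrow> ('n, 'k) mpoly" where
  "LM \<tau> f = Poly_Mapping.single (LT \<tau> f) (LC \<tau> f)"

definition LTs :: "('n trm \<Rightarrow> 'n trm \<Rightarrow> bool) \<Rightarrow> ('n, 'k::zero) mpoly set \<Rightarrow> 'n trm set" where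
  "LTs \<tau> A = LT \<tau> ` (A - {0})"

section \<open>Ideals and Groebner bases\<close>

definition ideal_gen :: "'a::comm_ring_1 set \<Rightarrow> 'a set" where
  "ideal_gen A = module.span (*) A"

definition groebner_basis ::
    "('n trm \<Rightarrow> 'n trm \<Rightarrow> bool) \<Rightarrow> ('n, 'k::field) mpoly set \<Rightarrow> ('n, 'k) mpoly set \<Rightarrow> bool" where
  "groebner_basis \<tau> B I \<longleftrightarrow>
     finite B \<and> B \<subseteq> I \<and>
     ideal_gen ((\<lambda>t. Poly_Mapping.single t (1::'k)) ` LTs \<tau> B) =
     ideal_gen ((\<lambda>t. Poly_Mapping.single t (1::'k)) ` LTs \<tau> I)"

section \<open>Critical pairs and selection functions\<close>

type_synonym ('n, 'k) cpair = "'n trm \<times> ('n, 'k) mpoly \<times> ('n, 'k) mpoly"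

text \<open>Here \<open>single (LT \<tau> g - trm_gcd (LT \<tau> f) (LT \<tau> g)) (LC \<tau> g)\<close> is
  $\mathrm{LM}(g)/\gcd(\mathrm{LT}(f),\mathrm{LT}(g))$.\<close>

definition s_half ::
    "('n trm \<Rightarrow> 'n trm \<Rightarrow> bool) \<Rightarrow> ('n, 'k::field) mpoly \<Rightarrow> ('n, 'k) mpoly \<Rightarrow> ('n, 'k) mpoly" where
  "s_half \<tau> f g =
     Poly_Mapping.single (LT \<tau> g - trm_gcd (LT \<tau> f) (LT \<tau> g)) (LC \<tau> g) * f"

definition crit_pair ::
    "('n trm \<Rightarrow> 'n trm \<Rightarrow> bool) \<Rightarrow> ('n, 'k::field) mpoly \<Rightarrow> ('n, 'k) mpoly \<Rightarrow> ('n, 'k) cpair" where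
  "crit_pair \<tau> f g = (trm_lcm (LT \<tau> f) (LT \<tau> g), s_half \<tau> f g, s_half \<tau> g f)"

text \<open>A sublist need not be contiguous. Nothing is required of \<open>Sel\<close> on lists containing
  triples that are not critical pairs.\<close>

definition selection_function ::
    "('n trm \<Rightarrow> 'n trm \<Rightarrow> bool) \<Rightarrow> (('n, 'k::field) cpair list \<Rightarrow> ('n, 'k) cpair list) \<Rightarrow> bool" where
  "selection_function \<tau> Sel \<longleftrightarrow>
     (\<forall>l. set l \<subseteq> {crit_pair \<tau> f g |f g. f \<noteq> 0 \<and> g \<noteq> 0} \<longrightarrow>
        subseq (Sel l) l \<and> (l \<noteq> [] \<longrightarrow> Sel l \<noteq> []))"

text \<open>\<open>P\<close> lists all critical pairs of distinct elements of \<open>G\<close>, exactly one for each unordered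
  pair; the enumeration order and the orientation of each pair are left open.\<close>

definition all_pairs ::
    "('n trm \<Rightarrow> 'n trm \<Rightarrow> bool) \<Rightarrow> ('n, 'k::field) mpoly list \<Rightarrow> ('n, 'k) cpair list \<Rightarrow> bool" where
  "all_pairs \<tau> G P \<longleftrightarrow>
     (\<exists>qs. P = map (\<lambda>(f, g). crit_pair \<tau> f g) qs \<and>
           distinct (map (\<lambda>(f, g). {f, g}) qs) \<and>
           set (map (\<lambda>(f, g). {f, g}) qs) = {{f, g} |f g. f \<in> set G \<and> g \<in> set G \<and> f \<noteq> g})"

definition halves :: "('n, 'k) cpair list \<Rightarrow> ('n, 'k) mpoly list" where
  "halves P = concat (map (\<lambda>(m, p, q). [p, q]) P)"

section \<open>Reduced row echelon form of a list of polynomials\<close>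

definition supp_list ::
    "('n trm \<Rightarrow> 'n trm \<Rightarrow> bool) \<Rightarrow> ('n, 'k::zero) mpoly list \<Rightarrow> 'n trm list" where
  "supp_list \<tau> F = (THE ts. set ts = Supp F \<and> sorted_wrt (\<lambda>s t. \<tau> t s \<and> s \<noteq> t) ts)"

definition poly_matrix ::
    "('n trm \<Rightarrow> 'n trm \<Rightarrow> bool) \<Rightarrow> ('n, 'k::zero) mpoly list \<Rightarrow> 'k mat" where
  "poly_matrix \<tau> F =
     mat (length F) (length (supp_list \<tau> F))
       (\<lambda>(i, j). Poly_Mapping.lookup (F ! i) (supp_list \<tau> F ! j))"

text \<open>The library's \<^const>\<open>row_echelon_form\<close> is the reduced one: pivots are 1 and are the only
  nonzero entries of their columns. \<^const>\<open>gauss_jordan_single\<close> computes it.\<close>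

definition rref ::
    "('n trm \<Rightarrow> 'n trm \<Rightarrow> bool) \<Rightarrow> ('n, 'k::field) mpoly list \<Rightarrow> ('n, 'k) mpoly list" where
  "rref \<tau> F =
     (let ts = supp_list \<tau> F; B = gauss_jordan_single (poly_matrix \<tau> F)
      in map (\<lambda>r. \<Sum>j<length ts. Poly_Mapping.single (ts ! j) (r $ j))
           (filter (\<lambda>r. r \<noteq> 0\<^sub>v (length ts)) (rows B)))"

definition rref_plus ::
    "('n trm \<Rightarrow> 'n trm \<Rightarrow> bool) \<Rightarrow> ('n, 'k::field) mpoly list \<Rightarrow> ('n, 'k) mpoly list" where
  "rref_plus \<tau> F = filter (\<lambda>f. LT \<tau> f \<notin> LTs \<tau> (set F)) (rref \<tau> F)"

section \<open>The algorithm\<close>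

text \<open>The algorithm is nondeterministic, so it is modelled as a transition system.
  \<open>symPre_step \<tau> G\<close> is one pass through the loop body of symbolic preprocessing, acting on the
  program variables $(F, \mathrm{Done})$.\<close>

inductive symPre_step ::
    "('n trm \<Rightarrow> 'n trm \<Rightarrow> bool) \<Rightarrow> ('n, 'k::field) mpoly list \<Rightarrow>
     ('n, 'k) mpoly list \<times> 'n trm set \<Rightarrow> ('n, 'k) mpoly list \<times> 'n trm set \<Rightarrow> bool"
  for \<tau> G where
  append:
    "\<lbrakk>t \<in> Supp F - Done; g \<in> set G; t = t' + LT \<tau> g\<rbrakk> \<Longrightarrow>
     symPre_step \<tau> G (F, Done) (F @ [Poly_Mapping.single t' 1 * g], insert t Done)"
| skip:
    "\<lbrakk>t \<in> Supp F - Done; \<not> (\<exists>g\<in>set G. \<exists>t'. t = t' + LT \<tau> g)\<rbrakk> \<Longrightarrow>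
     symPre_step \<tau> G (F, Done) (F, insert t Done)"

fun add_elem ::
    "('n trm \<Rightarrow> 'n trm \<Rightarrow> bool) \<Rightarrow> ('n, 'k::field) mpoly \<Rightarrow>
     ('n, 'k) mpoly list \<times> ('n, 'k) cpair list \<Rightarrow> ('n, 'k) mpoly list \<times> ('n, 'k) cpair list" where
  "add_elem \<tau> h (G, P) = (G @ [h], P @ map (crit_pair \<tau> h) G)"

text \<open>Control states: \<open>Start F\<close> is the input; \<open>Loop G P\<close> is the head of the main loop;
  \<open>SymPre G P F Done\<close> is the head of the symbolic preprocessing loop inside the main loop, where
  \<open>P\<close> no longer contains the selected pairs.\<close>

datatype ('t, 'p) f4_state =
  Start "'p list"
| Loop "'p list" "('t \<times> 'p \<times> 'p) list"
| SymPre "'p list" "('t \<times> 'p \<times> 'p) list" "'p list" "'t set"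

text \<open>In \<open>select\<close>, the premise on \<^const>\<open>shuffles\<close> says that \<open>P'\<close> is left when the selected
  sublist is removed from \<open>P\<close>. A run returns \<open>G\<close> when it arrives at \<open>Loop G []\<close>.\<close>

inductive f4_step ::
    "('n trm \<Rightarrow> 'n trm \<Rightarrow> bool) \<Rightarrow> (('n, 'k::field) cpair list \<Rightarrow> ('n, 'k) cpair list) \<Rightarrow>
     ('n trm, ('n, 'k) mpoly) f4_state \<Rightarrow> ('n trm, ('n, 'k) mpoly) f4_state \<Rightarrow> bool"
  for \<tau> Sel where
  init:
    "all_pairs \<tau> F P \<Longrightarrow> f4_step \<tau> Sel (Start F) (Loop F P)"
| select:
    "\<lbrakk>P \<noteq> []; P \<in> shuffles (Sel P) P'; L = halves (Sel P)\<rbrakk> \<Longrightarrow>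
     f4_step \<tau> Sel (Loop G P) (SymPre G P' L (LTs \<tau> (set L)))"
| preprocess:
    "\<lbrakk>Supp F \<noteq> Done; symPre_step \<tau> G (F, Done) (F', Done')\<rbrakk> \<Longrightarrow>
     f4_step \<tau> Sel (SymPre G P F Done) (SymPre G P F' Done')"
| update:
    "\<lbrakk>Supp F = Done; (G', P') = fold (add_elem \<tau>) (rref_plus \<tau> F) (G, P)\<rbrakk> \<Longrightarrow>
     f4_step \<tau> Sel (SymPre G P F Done) (Loop G' P')"

text \<open>The total correctness of a nondeterministic program: no run is infinite, and every run that
  cannot be continued has returned a result satisfying \<open>Q\<close>.\<close>

definition f4_terminates_with ::
    "('n trm \<Rightarrow> 'n trm \<Rightarrow> bool) \<Rightarrow> (('n, 'k::field) cpair list \<Rightarrow> ('n, 'k) cpair list) \<Rightarrow>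
     ('n, 'k) mpoly list \<Rightarrow> (('n, 'k) mpoly list \<Rightarrow> bool) \<Rightarrow> bool" where
  "f4_terminates_with \<tau> Sel F Q \<longleftrightarrow>
     \<not> (\<exists>\<sigma>. \<sigma> 0 = Start F \<and> (\<forall>i::nat. f4_step \<tau> Sel (\<sigma> i) (\<sigma> (Suc i)))) \<and>
     (\<forall>s. (f4_step \<tau> Sel)\<^sup>*\<^sup>* (Start F) s \<and> \<not> (\<exists>s'. f4_step \<tau> Sel s s') \<longrightarrow>
          (\<exists>G. s = Loop G [] \<and> Q G))"

end

(*
  A run terminates because every pass through the main loop either enlarges the monomial ideal
  generated by LT(G), which can happen only finitely often by Dickson's lemma, or leaves G alone and
  shortens the list of pairs; symbolic preprocessing terminates because it replaces an unprocessed
  term by finitely many smaller ones.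

  For correctness, all rows handed to the echelon form are monomial multiples of elements of G, and
  the leading term of any nonzero element of their k-span is the leading term of a row of the echelon
  form, hence divisible by the leading term of an element of G or of an appended element.  So every
  element of the span, in particular the S-polynomial of a selected pair, has a representation over
  the new G whose terms do not exceed its own leading term.  When no pair is left, Buchberger's
  criterion applies.
*)
theory Submission
  imports Defs "HOL-Library.Multiset"
begin

section \<open>Divisibility of terms and Dickson's lemma\<close>

text \<open>The monomial ideal grows because of what symbolic preprocessing leaves behind: at its
  exit every term of the rows is the leading term of a row or divisible by no leading term of
  \<open>G\<close>. An appended element has its leading term among the terms of the rows but not
  among their leading terms, so it is new to the monomial ideal. Correctness rests on row reduction
  instead. The obstacle there is that a pair leaves the list when it is selected, before anything is
  known about its S-polynomial; the invariant \<open>covered\<close> bridges this gap. Buchberger's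
  criterion is used with representations strictly below the lcm of the leading terms: the sets
  \<open>rep G A\<close> can only grow with \<open>G\<close>, so a pair once settled stays settled
  whatever is appended later.\<close>

definition trm_dvd :: "'n trm \<Rightarrow> 'n trm \<Rightarrow> bool" where
  "trm_dvd s t \<longleftrightarrow> (\<exists>u. t = s + u)"

lemma trm_dvd_iff: "trm_dvd s t \<longleftrightarrow> (\<forall>i. Poly_Mapping.lookup s i \<le> Poly_Mapping.lookup t i)"
proof
  assume "\<forall>i. Poly_Mapping.lookup s i \<le> Poly_Mapping.lookup t i"
  then have "t = s + (t - s)"
    by (intro poly_mapping_eqI) (simp add: lookup_add lookup_minus)
  then show "trm_dvd s t" unfolding trm_dvd_def by blast
qed (auto simp: trm_dvd_def lookup_add)

lemma trm_dvd_diff: "trm_dvd s t \<Longrightarrow> t - s + s = t"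
  by (auto simp: trm_dvd_def add.commute)

lemma trm_dvd_trans: "trm_dvd s t \<Longrightarrow> trm_dvd t u \<Longrightarrow> trm_dvd s u"
  unfolding trm_dvd_iff by (meson le_trans)

lemma trm_dvd_lcm [simp]: "trm_dvd s (trm_lcm s t)" "trm_dvd t (trm_lcm s t)"
  by (simp_all add: trm_dvd_iff trm_lcm.rep_eq)

lemma trm_lcm_least: "trm_dvd s u \<Longrightarrow> trm_dvd t u \<Longrightarrow> trm_dvd (trm_lcm s t) u"
  by (simp add: trm_dvd_iff trm_lcm.rep_eq)

lemma trm_lcm_commute: "trm_lcm s t = trm_lcm t s"
  by transfer (simp add: max.commute)

lemma trm_diff_gcd: "t - trm_gcd s t = trm_lcm s t - s"
  by (intro poly_mapping_eqI) (simp add: lookup_minus trm_lcm.rep_eq trm_gcd.rep_eq)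

text \<open>Some subsequence is monotone; if it is decreasing, well-ordering of the naturals makes
  it constant from the point where it reaches its least value, so a tail of it is
  nondecreasing.\<close>

lemma nat_seq_mono_subseq:
  fixes a :: "nat \<Rightarrow> nat"
  shows "\<exists>r :: nat \<Rightarrow> nat. strict_mono r \<and> (\<forall>i j. i \<le> j \<longrightarrow> a (r i) \<le> a (r j))"
proof -
  obtain r where r: "strict_mono r" "monoseq (\<lambda>n. a (r n))"
    using seq_monosub[of a] by blast
  from r(2) consider "\<forall>m. \<forall>n\<ge>m. a (r m) \<le> a (r n)" | "\<forall>m. \<forall>n\<ge>m. a (r n) \<le> a (r m)"
    unfolding monoseq_def by blast
  then show ?thesis
  proof cases
    case 1
    with r(1) show ?thesis by (intro exI[of _ r] conjI allI impI) simp_all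
  next
    case 2
    define m where "m = (LEAST v. \<exists>n. a (r n) = v)"
    have "\<exists>n. a (r n) = m" unfolding m_def by (rule LeastI_ex) blast
    then obtain n where n: "a (r n) = m" by blast
    have "a (r (n + i)) = m" for i
    proof (rule antisym)
      show "a (r (n + i)) \<le> m" using 2 n by (metis le_add1)
      show "m \<le> a (r (n + i))" unfolding m_def by (rule Least_le) blast
    qed
    moreover have "strict_mono (\<lambda>i. r (n + i))"
      using r(1) by (simp add: strict_mono_def)
    ultimately show ?thesis by (intro exI[of _ "\<lambda>i. r (n + i)"]) simp
  qed
qed

text \<open>Coordinates are treated one at a time: passing to a further subsequence keeps the
  earlier ones nondecreasing. The set \<open>I\<close> is there to induct on and later becomes the
  set of all variables.\<close>

lemma dickson_mono_subseq:
  fixes a :: "nat \<Rightarrow> 'n trm"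
  assumes "finite I"
  shows "\<exists>r :: nat \<Rightarrow> nat. strict_mono r \<and>
    (\<forall>x\<in>I. \<forall>i j. i \<le> j \<longrightarrow> Poly_Mapping.lookup (a (r i)) x \<le> Poly_Mapping.lookup (a (r j)) x)"
  using assms
proof (induction I rule: finite_induct)
  case empty
  show ?case by (rule exI[of _ id]) (simp add: strict_mono_def)
next
  case (insert y I)
  then obtain r :: "nat \<Rightarrow> nat" where r: "strict_mono r"
    "\<forall>x\<in>I. \<forall>i j. i \<le> j \<longrightarrow> Poly_Mapping.lookup (a (r i)) x \<le> Poly_Mapping.lookup (a (r j)) x"
    using insert.IH by metis
  obtain q :: "nat \<Rightarrow> nat" where q: "strict_mono q"
    "\<forall>i j. i \<le> j \<longrightarrow> Poly_Mapping.lookup (a (r (q i))) y \<le> Poly_Mapping.lookup (a (r (q j))) y"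
    using nat_seq_mono_subseq[of "\<lambda>i. Poly_Mapping.lookup (a (r i)) y"] by blast
  have "strict_mono (r \<circ> q)" using r(1) q(1) by (simp add: strict_mono_o)
  have "q i \<le> q j" if "i \<le> j" for i j
    using q(1) that by (simp add: strict_mono_less_eq)
  then have "\<forall>x\<in>insert y I. \<forall>i j. i \<le> j \<longrightarrow>
      Poly_Mapping.lookup (a ((r \<circ> q) i)) x \<le> Poly_Mapping.lookup (a ((r \<circ> q) j)) x"
    using r(2) q(2) by simp
  with \<open>strict_mono (r \<circ> q)\<close> show ?case by (intro exI[of _ "r \<circ> q"] conjI)
qed

theorem dickson:
  fixes a :: "nat \<Rightarrow> 'n::finite trm"
  shows "\<exists>i j. i < j \<and> trm_dvd (a i) (a j)"
proof -
  obtain r :: "nat \<Rightarrow> nat" where r: "strict_mono r"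
    "\<forall>x. \<forall>i j. i \<le> j \<longrightarrow> Poly_Mapping.lookup (a (r i)) x \<le> Poly_Mapping.lookup (a (r j)) x"
    using dickson_mono_subseq[of UNIV a] by auto
  have "r 0 < r 1" using r(1) by (simp add: strict_mono_def)
  moreover have "trm_dvd (a (r 0)) (a (r 1))" using r(2) by (simp add: trm_dvd_iff)
  ultimately show ?thesis by blast
qed

text \<open>The ascending chain condition for monomial ideals; the larger set stands first so that
  growth counts as descent. Pick a new term \<open>a i\<close> at each stage of a chain: Dickson's
  lemma gives \<open>i < j\<close> with \<open>a i\<close> dividing \<open>a j\<close>, and upward
  closure then puts \<open>a j\<close> into \<open>A j\<close>, where it was supposed to be
  missing.\<close>

lemma wf_upset_growth:
  "wf {(B, A :: 'n::finite trm set). A \<subset> B \<and> (\<forall>s t. s \<in> A \<longrightarrow> trm_dvd s t \<longrightarrow> t \<in> A)}"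
  unfolding wf_iff_no_infinite_down_chain
proof (intro notI, elim exE)
  fix A :: "nat \<Rightarrow> 'n trm set"
  assume A: "\<forall>i. (A (Suc i), A i) \<in> {(B, A). A \<subset> B \<and> (\<forall>s t. s \<in> A \<longrightarrow> trm_dvd s t \<longrightarrow> t \<in> A)}"
  then have "\<forall>i. \<exists>t. t \<in> A (Suc i) - A i" by auto
  then obtain a where a: "\<And>i. a i \<in> A (Suc i) - A i" by metis
  obtain i j where ij: "i < j" "trm_dvd (a i) (a j)" using dickson by blast
  have "A m \<subseteq> A (Suc m)" for m using A by auto
  then have "A (Suc i) \<subseteq> A j" using ij(1) by (intro lift_Suc_mono_le[of A "Suc i" j]) auto
  then have "a i \<in> A j" using a by blast
  then have "a j \<in> A j" using A ij(2) by auto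
  then show False using a by blast
qed

section \<open>Monomial multiples of a polynomial\<close>

lemma lookup_single_times:
  fixes f :: "'n trm \<Rightarrow>\<^sub>0 'k::comm_ring_1"
  shows "Poly_Mapping.lookup (Poly_Mapping.single s c * f) (s + t) = c * Poly_Mapping.lookup f t"
proof -
  have "Poly_Mapping.lookup (Poly_Mapping.single s c * f) (s + t) =
      (\<Sum>l. (c * (\<Sum>q. Poly_Mapping.lookup f q when s + t = l + q) when s = l))"
    by (simp only: lookup_mult lookup_single when_mult)
  also have "\<dots> = c * (\<Sum>q. Poly_Mapping.lookup f q when s + t = s + q)"
    by (rule Sum_any_when_equal')
  also have "\<dots> = c * Poly_Mapping.lookup f t"
    by (simp only: add_left_cancel Sum_any_when_equal')
  finally show ?thesis .
qed

lemma keys_single_times: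
  fixes f :: "('n, 'k::field) mpoly"
  shows "Poly_Mapping.keys (Poly_Mapping.single s c * f) =
    (if c = 0 then {} else (\<lambda>t. s + t) ` Poly_Mapping.keys f)"
proof -
  have "Poly_Mapping.keys (Poly_Mapping.single s c * f) \<subseteq> (\<lambda>t. s + t) ` Poly_Mapping.keys f"
    using keys_mult[of "Poly_Mapping.single s c" f] by (auto split: if_splits)
  moreover have "s + t \<in> Poly_Mapping.keys (Poly_Mapping.single s c * f)"
    if "c \<noteq> 0" "t \<in> Poly_Mapping.keys f" for t
    using that by (simp add: in_keys_iff lookup_single_times)
  ultimately show ?thesis by auto
qed

section \<open>Leading terms\<close>

locale term_ord =
  fixes \<tau> :: "'n::finite trm \<Rightarrow> 'n trm \<Rightarrow> bool"
  assumes term_order: "term_order \<tau>"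
begin

abbreviation lt :: "'n trm \<Rightarrow> 'n trm \<Rightarrow> bool" where
  "lt s t \<equiv> \<tau> s t \<and> \<not> \<tau> t s"

sublocale ord: linorder \<tau> lt
  using term_order by (simp add: term_order_def)

lemma le_add: "\<tau> s t \<Longrightarrow> \<tau> (u + s) (u + t)"
  using term_order by (simp add: term_order_def add.commute[of u])

lemma lt_add: "lt s t \<Longrightarrow> lt (u + s) (u + t)"
  using le_add ord.order_antisym by (metis add_left_imp_eq)

lemma dvd_le: "trm_dvd s t \<Longrightarrow> \<tau> s t"
  using term_order by (simp add: term_order_def trm_dvd_def)

text \<open>In any infinite descent Dickson's lemma finds an earlier term dividing a later one, and
  a term order puts the divisor below its multiple.\<close>

lemma wf_lt: "wf {(s, t). lt s t}"
  unfolding wf_iff_no_infinite_down_chain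
proof (intro notI, elim exE)
  fix a assume a: "\<forall>i. (a (Suc i), a i) \<in> {(s, t). lt s t}"
  obtain i j where "i < j" "trm_dvd (a i) (a j)" using dickson by blast
  moreover have "lt (a j) (a i)" if "i < j" for i j
    using that
  proof (induction j)
    case (Suc j)
    have "lt (a (Suc j)) (a j)" using a by simp
    then show ?case using Suc by (cases "i = j") (auto intro: ord.less_trans)
  qed simp
  ultimately show False using dvd_le by blast
qed

lemma LT_unique: "t \<in> Poly_Mapping.keys f \<Longrightarrow> (\<And>s. s \<in> Poly_Mapping.keys f \<Longrightarrow> \<tau> s t) \<Longrightarrow> LT \<tau> f = t"
  unfolding LT_def by (rule the_equality) (auto intro: ord.order_antisym)

lemma LT_props:
  assumes "f \<noteq> 0"
  shows LT_in_keys: "LT \<tau> f \<in> Poly_Mapping.keys f"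
    and le_LT: "\<And>s. s \<in> Poly_Mapping.keys f \<Longrightarrow> \<tau> s (LT \<tau> f)"
proof -
  have "Poly_Mapping.keys f \<noteq> {}" using assms by simp
  then have "ord.Max (Poly_Mapping.keys f) \<in> Poly_Mapping.keys f"
    "\<And>s. s \<in> Poly_Mapping.keys f \<Longrightarrow> \<tau> s (ord.Max (Poly_Mapping.keys f))"
    by auto
  then show "LT \<tau> f \<in> Poly_Mapping.keys f" "\<And>s. s \<in> Poly_Mapping.keys f \<Longrightarrow> \<tau> s (LT \<tau> f)"
    using LT_unique by metis+
qed

lemma LC_nonzero: "f \<noteq> 0 \<Longrightarrow> LC \<tau> f \<noteq> 0"
  using LT_in_keys by (auto simp: LC_def in_keys_iff)

lemma single_times_nonzero:
  fixes f :: "('n, 'k::field) mpoly"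
  shows "c \<noteq> 0 \<Longrightarrow> f \<noteq> 0 \<Longrightarrow> Poly_Mapping.single s c * f \<noteq> 0"
  using keys_single_times[of s c f] by (metis image_is_empty keys_eq_empty)

lemma LT_single_times:
  fixes f :: "('n, 'k::field) mpoly"
  shows "c \<noteq> 0 \<Longrightarrow> f \<noteq> 0 \<Longrightarrow> LT \<tau> (Poly_Mapping.single s c * f) = s + LT \<tau> f"
  by (rule LT_unique) (auto simp: keys_single_times LT_in_keys intro: le_add le_LT)

lemma LC_single_times:
  fixes f :: "('n, 'k::field) mpoly"
  shows "c \<noteq> 0 \<Longrightarrow> f \<noteq> 0 \<Longrightarrow> LC \<tau> (Poly_Mapping.single s c * f) = c * LC \<tau> f"
  by (simp add: LC_def LT_single_times lookup_single_times)

lemma LT_lt_if_cancels: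
  assumes "f \<noteq> 0" "\<And>s. s \<in> Poly_Mapping.keys f \<Longrightarrow> \<tau> s t" "Poly_Mapping.lookup f t = 0"
  shows "lt (LT \<tau> f) t"
  using assms LT_in_keys[OF assms(1)] by (metis in_keys_iff ord.order_antisym)

text \<open>As a quotient of terms, LT(g)/gcd equals lcm/LT(f); in the second form it is visible
  that the factor raises the leading term of \<open>f\<close> to the lcm.\<close>

lemma s_half_eq:
  "s_half \<tau> f g = Poly_Mapping.single (trm_lcm (LT \<tau> f) (LT \<tau> g) - LT \<tau> f) (LC \<tau> g) * f"
  by (simp add: s_half_def trm_diff_gcd)

lemma s_half_nonzero:
  fixes f g :: "('n, 'k::field) mpoly"
  shows "f \<noteq> 0 \<Longrightarrow> g \<noteq> 0 \<Longrightarrow> s_half \<tau> f g \<noteq> 0"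
  by (simp add: s_half_def single_times_nonzero LC_nonzero)

lemma LT_s_half:
  fixes f g :: "('n, 'k::field) mpoly"
  shows "f \<noteq> 0 \<Longrightarrow> g \<noteq> 0 \<Longrightarrow> LT \<tau> (s_half \<tau> f g) = trm_lcm (LT \<tau> f) (LT \<tau> g)"
  by (simp add: s_half_eq LT_single_times LC_nonzero trm_dvd_diff)

text \<open>The value is symmetric in \<open>f\<close> and \<open>g\<close>, so the two halves
  cancel at the lcm when subtracted, without any division.\<close>

lemma LC_s_half:
  fixes f g :: "('n, 'k::field) mpoly"
  shows "f \<noteq> 0 \<Longrightarrow> g \<noteq> 0 \<Longrightarrow> LC \<tau> (s_half \<tau> f g) = LC \<tau> f * LC \<tau> g"
  by (simp add: s_half_eq LC_single_times LC_nonzero)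

end

section \<open>Bounded representations and Buchberger's criterion\<close>

text \<open>Scalars act as constant polynomials. Thus \<open>mp.span\<close> is the linear span over
  the field, that is, the row space of a list of polynomials, whereas \<open>idl.span\<close> below
  is the generated ideal.\<close>

global_interpretation mp: vector_space
  "\<lambda>(c :: 'k::field) (f :: ('n, 'k) mpoly). Poly_Mapping.single 0 c * f"
  by unfold_locales (simp_all add: algebra_simps single_add mult_single flip: mult.assoc)

global_interpretation idl: Modules.module "(*) :: 'a::comm_ring_1 \<Rightarrow> 'a \<Rightarrow> 'a"
  by unfold_locales (simp_all add: algebra_simps)

text \<open>As a simp rule this is \<open>mult.assoc\<close> reversed, which loops with \<open>algebra_simps\<close>.\<close>
declare idl.scale_scale [simp del]

lemma sum_single_lookup:
  "(\<Sum>k\<in>Poly_Mapping.keys f. Poly_Mapping.single k (Poly_Mapping.lookup f k)) = f"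
proof (rule poly_mapping_eqI)
  fix t
  show "Poly_Mapping.lookup (\<Sum>k\<in>Poly_Mapping.keys f.
      Poly_Mapping.single k (Poly_Mapping.lookup f k)) t = Poly_Mapping.lookup f t"
    by (simp add: lookup_sum lookup_single when_def in_keys_iff)
qed

lemma single_mult_assoc:
  fixes f :: "('n, 'k::field) mpoly"
  shows "Poly_Mapping.single s a * (Poly_Mapping.single t b * f) = Poly_Mapping.single (s + t) (a * b) * f"
  by (simp add: mult_single flip: mult.assoc)

lemma single_scale_eq:
  fixes f :: "('n, 'k::field) mpoly"
  shows "Poly_Mapping.single s c * f = Poly_Mapping.single 0 c * (Poly_Mapping.single s 1 * f)"
  by (simp add: single_mult_assoc)

context term_ord
begin

text \<open>The set \<open>A\<close> bounds the leading term of every summand and not merely of the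
  sum. With \<open>A = UNIV\<close> this is the whole ideal; with the terms at most
  \<open>t\<close>, or strictly below \<open>t\<close>, it gives the bounded representations of
  Buchberger's criterion.\<close>

definition rep :: "('n, 'k::field) mpoly set \<Rightarrow> 'n trm set \<Rightarrow> ('n, 'k) mpoly set" where
  "rep G A = mp.span {Poly_Mapping.single s 1 * g |s g. g \<in> G \<and> s + LT \<tau> g \<in> A}"

lemma rep_mono: "G \<subseteq> H \<Longrightarrow> A \<subseteq> B \<Longrightarrow> rep G A \<subseteq> rep H B"
  unfolding rep_def by (intro mp.span_mono) blast

lemma rep_monomial: "g \<in> G \<Longrightarrow> s + LT \<tau> g \<in> A \<Longrightarrow> Poly_Mapping.single s c * g \<in> rep G A"
  unfolding rep_def by (subst single_scale_eq) (intro mp.span_scale mp.span_base, blast)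

lemma rep_add: "p \<in> rep G A \<Longrightarrow> q \<in> rep G A \<Longrightarrow> p + q \<in> rep G A"
  and rep_zero: "0 \<in> rep G A"
  by (auto simp: rep_def intro: mp.span_add mp.span_zero)

lemma rep_induct [consumes 1, case_names zero step]:
  assumes "p \<in> rep G A"
    and "P 0"
    and "\<And>s c g q. g \<in> G \<Longrightarrow> s + LT \<tau> g \<in> A \<Longrightarrow> q \<in> rep G A \<Longrightarrow> P q \<Longrightarrow> P (Poly_Mapping.single s c * g + q)"
  shows "P p"
proof -
  \<comment> \<open>Membership is carried along because the step case of the rule offers it for the
    remainder \<open>q\<close>.\<close>
  have "p \<in> rep G A \<and> P p"
    using assms(1)[unfolded rep_def]
  proof (induction rule: mp.span_induct_alt)
    case base
    show ?case using assms(2) by (simp add: rep_zero)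
  next
    case (step c x y)
    then obtain s g where "x = Poly_Mapping.single s 1 * g" "g \<in> G" "s + LT \<tau> g \<in> A" by blast
    moreover from this have "Poly_Mapping.single 0 c * x = Poly_Mapping.single s c * g"
      using single_scale_eq[of s c g] by simp
    ultimately show ?case
      using step assms(3)[of g s y c] rep_add[OF rep_monomial[of g G s A c], of y] by simp
  qed
  then show ?thesis by blast
qed

lemma rep_times:
  assumes "p \<in> rep G A" "\<And>a. a \<in> A \<Longrightarrow> u + a \<in> B"
  shows "Poly_Mapping.single u c * p \<in> rep G B"
  using assms(1)
proof (induction rule: rep_induct)
  case (step s d g q)
  have "Poly_Mapping.single (u + s) (c * d) * g \<in> rep G B"
    using step assms(2) by (intro rep_monomial) (simp_all add: add.assoc)
  then have "Poly_Mapping.single (u + s) (c * d) * g + Poly_Mapping.single u c * q \<in> rep G B"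
    using step by (intro rep_add)
  then show ?case by (simp only: distrib_left single_mult_assoc)
qed (simp add: rep_zero)

lemma rep_keys:
  assumes "p \<in> rep G A" "0 \<notin> G" "t \<in> Poly_Mapping.keys p"
  shows "\<exists>a\<in>A. \<tau> t a"
  using assms(1,3)
proof (induction arbitrary: t rule: rep_induct)
  case (step s c g q)
  consider "t \<in> Poly_Mapping.keys q" | "t \<in> Poly_Mapping.keys (Poly_Mapping.single s c * g)"
    using step.prems keys_add[of "Poly_Mapping.single s c * g" q] by auto
  then show ?case
  proof cases
    case 1
    then show ?thesis by (rule step.IH)
  next
    case 2
    then obtain u where u: "u \<in> Poly_Mapping.keys g" "t = s + u"
      by (auto simp: keys_single_times split: if_splits)
    have "g \<noteq> 0" using step.hyps(1) assms(2) by metis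
    then have "\<tau> t (s + LT \<tau> g)" using le_LT[of g u] le_add u by simp
    then show ?thesis using step.hyps(2) by blast
  qed
qed simp

lemma ideal_gen_eq_rep:
  fixes G :: "('n, 'k::field) mpoly set"
  shows "ideal_gen G = rep G UNIV"
proof
  show "rep G UNIV \<subseteq> ideal_gen G"
  proof
    fix p assume "p \<in> rep G UNIV"
    then show "p \<in> ideal_gen G"
      unfolding ideal_gen_def
      by (induction rule: rep_induct)
        (auto intro: idl.span_zero idl.span_add idl.span_scale idl.span_base)
  qed
  show "ideal_gen G \<subseteq> rep G UNIV"
    unfolding ideal_gen_def
  proof (rule idl.span_minimal)
    show "G \<subseteq> rep G UNIV" using rep_monomial[of _ G 0 UNIV 1] by auto
    show "idl.subspace (rep G UNIV)"
    proof (rule idl.subspaceI)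
      fix f p :: "('n, 'k) mpoly" assume p: "p \<in> rep G UNIV"
      \<comment> \<open>An arbitrary multiplier is split into its monomials, to which
        \<open>rep_times\<close> applies; a free finite \<open>K\<close> lets the induction leave
        the coefficients of \<open>f\<close> alone.\<close>
      have "(\<Sum>k\<in>K. Poly_Mapping.single k (Poly_Mapping.lookup f k)) * p \<in> rep G UNIV"
        if "finite K" for K
        using that
        by (induction rule: finite_induct)
          (auto simp: rep_zero distrib_right intro: rep_add rep_times[OF p])
      from this[of "Poly_Mapping.keys f"] show "f * p \<in> rep G UNIV"
        by (simp add: sum_single_lookup)
    qed (auto intro: rep_zero rep_add)
  qed
qed

text \<open>Only finitely many summands occur, so their leading terms have a maximum, and it belongs
  to \<open>A\<close>. The alternative \<open>p = 0\<close> accounts for the empty sum, which has no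
  such maximum.\<close>

lemma rep_bounded:
  assumes "p \<in> rep G A"
  shows "p = 0 \<or> (\<exists>t\<in>A. p \<in> rep G {s. \<tau> s t})"
  using assms
proof (induction rule: rep_induct)
  case (step s c g q)
  let ?t = "s + LT \<tau> g"
  have m: "Poly_Mapping.single s c * g \<in> rep G {s. \<tau> s ?t}"
    using step by (intro rep_monomial) auto
  show ?case
  proof (cases "q = 0")
    case True
    then show ?thesis using m step by auto
  next
    case False
    then obtain t where t: "t \<in> A" "q \<in> rep G {s. \<tau> s t}" using step by blast
    let ?m = "if \<tau> t ?t then ?t else t"
    have "{s. \<tau> s ?t} \<subseteq> {s. \<tau> s ?m}" "{s. \<tau> s t} \<subseteq> {s. \<tau> s ?m}"
      using ord.linear by (auto intro: ord.order_trans)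
    then have "Poly_Mapping.single s c * g + q \<in> rep G {s. \<tau> s ?m}"
      using m t rep_mono by (intro rep_add) blast+
    moreover have "?m \<in> A" using t step by simp
    ultimately show ?thesis by blast
  qed
qed simp

text \<open>Buchberger's condition in its lcm form: all summands strictly below the lcm. This
  follows from reduction of the S-polynomial to zero, but is weaker.\<close>

definition spair_ok :: "('n, 'k::field) mpoly set \<Rightarrow> ('n, 'k) mpoly \<Rightarrow> ('n, 'k) mpoly \<Rightarrow> bool" where
  "spair_ok G f g \<longleftrightarrow>
     s_half \<tau> f g - s_half \<tau> g f \<in> rep G {s. lt s (trm_lcm (LT \<tau> f) (LT \<tau> g))}"

lemma spair_ok_self: "spair_ok G f f"
  by (simp add: spair_ok_def rep_zero)

lemma spair_ok_mono: "spair_ok G f g \<Longrightarrow> G \<subseteq> H \<Longrightarrow> spair_ok H f g"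
  unfolding spair_ok_def using rep_mono[OF _ subset_refl] by blast

text \<open>If \<open>h \<in> G\<close> has a leading term dividing \<open>t\<close>, then S-pairs let us trade every multiple of leading
  term \<open>t\<close> for a multiple of \<open>h\<close>; the total coefficient of the latter is the coefficient of \<open>t\<close>
  in \<open>p\<close>.\<close>

lemma rep_cancel:
  fixes G :: "('n, 'k::field) mpoly set"
  assumes G: "0 \<notin> G" "\<And>f g. f \<in> G \<Longrightarrow> g \<in> G \<Longrightarrow> spair_ok G f g"
    and p: "p \<in> rep G {s. \<tau> s t}" "Poly_Mapping.lookup p t = 0"
  shows "p \<in> rep G {s. lt s t}"
proof (cases "\<exists>h\<in>G. trm_dvd (LT \<tau> h) t")
  case False
  \<comment> \<open>No summand can reach \<open>t\<close>, so the given representation already lies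
    strictly below it.\<close>
  then have "s + LT \<tau> g \<noteq> t" if "g \<in> G" for s g
    using that unfolding trm_dvd_def by (metis add.commute)
  then have "{Poly_Mapping.single s 1 * g |s g. g \<in> G \<and> s + LT \<tau> g \<in> {s. \<tau> s t}} \<subseteq>
      {Poly_Mapping.single s (1::'k) * g |s g. g \<in> G \<and> s + LT \<tau> g \<in> {s. lt s t}}"
    using ord.order_antisym by blast
  then show ?thesis using p(1) mp.span_mono unfolding rep_def by blast
next
  case True
  then obtain h where h: "h \<in> G" "trm_dvd (LT \<tau> h) t" by blast
  have h0: "h \<noteq> 0" "LC \<tau> h \<noteq> 0" using h G LC_nonzero[of h] by metis+
  let ?m = "Poly_Mapping.single (t - LT \<tau> h)"
  \<comment> \<open>The S-polynomial of \<open>g\<close> and \<open>h\<close> is multiplied by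
    \<open>t - ?l\<close>, which lifts its bound from the lcm to \<open>t\<close>, and by
    \<open>1 / LC \<tau> h\<close>, which turns its first half into the monic multiple of
    \<open>g\<close>.\<close>
  have reduce: "Poly_Mapping.single s 1 * g - ?m (LC \<tau> g / LC \<tau> h) * h \<in> rep G {s. lt s t}"
    if g: "g \<in> G" "s + LT \<tau> g = t" for s g
  proof -
    let ?l = "trm_lcm (LT \<tau> g) (LT \<tau> h)"
    have "trm_dvd (LT \<tau> g) t" using g(2) by (auto simp: trm_dvd_def add.commute)
    then have lt: "trm_dvd ?l t" using h(2) by (rule trm_lcm_least)
    \<comment> \<open>Subtraction of exponents truncates at zero, so this telescoping depends on
      both divisibilities.\<close>
    have a: "t - ?l + (?l - LT \<tau> f) = t - LT \<tau> f" if "trm_dvd (LT \<tau> f) ?l" for f :: "('n, 'k) mpoly"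
      using that lt unfolding trm_dvd_iff
      by (intro poly_mapping_eqI) (simp add: lookup_add lookup_minus)
    have s: "t - LT \<tau> g = s" using g(2) by auto
    have "Poly_Mapping.single (t - ?l) (1 / LC \<tau> h) * (s_half \<tau> g h - s_half \<tau> h g)
        \<in> rep G {s. lt s t}"
    proof (rule rep_times)
      show "s_half \<tau> g h - s_half \<tau> h g \<in> rep G {s. lt s ?l}"
        using G(2)[OF g(1) h(1)] by (simp add: spair_ok_def)
      fix a assume "a \<in> {s. lt s ?l}"
      then have "lt (t - ?l + a) (t - ?l + ?l)" by (intro lt_add) simp
      then show "t - ?l + a \<in> {s. lt s t}" using lt by (simp add: trm_dvd_diff)
    qed
    moreover have "Poly_Mapping.single (t - ?l) (1 / LC \<tau> h) * s_half \<tau> g h = Poly_Mapping.single s 1 * g"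
      using h0 a[of g] s by (simp add: s_half_eq single_mult_assoc)
    moreover have "Poly_Mapping.single (t - ?l) (1 / LC \<tau> h) * s_half \<tau> h g = ?m (LC \<tau> g / LC \<tau> h) * h"
      using h0 a[of h] trm_lcm_commute[of "LT \<tau> h" "LT \<tau> g"]
      by (simp add: s_half_eq single_mult_assoc)
    ultimately show ?thesis by (simp add: right_diff_distrib)
  qed
  \<comment> \<open>All summands at level \<open>t\<close> are traded for \<open>h\<close> and
    collected into one coefficient \<open>c\<close>.\<close>
  have "\<exists>c. p - ?m c * h \<in> rep G {s. lt s t}"
    using p(1)
  proof (induction rule: rep_induct)
    case zero
    show ?case by (intro exI[of _ 0]) (simp add: rep_zero)
  next
    case (step s c g q)
    then obtain d where d: "q - ?m d * h \<in> rep G {s. lt s t}" by blast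
    show ?case
    proof (cases "s + LT \<tau> g = t")
      case True
      let ?e = "LC \<tau> g / LC \<tau> h"
      have "Poly_Mapping.single 0 c * (Poly_Mapping.single s 1 * g - ?m ?e * h) + (q - ?m d * h)
          \<in> rep G {s. lt s t}"
        using reduce[OF step(1) True] d by (intro rep_add rep_times[of _ _ "{s. lt s t}"]) auto
      moreover have "Poly_Mapping.single 0 c * (Poly_Mapping.single s 1 * g - ?m ?e * h) + (q - ?m d * h)
          = Poly_Mapping.single s c * g + q - ?m (c * ?e + d) * h"
        by (simp add: single_mult_assoc right_diff_distrib single_add distrib_right add_diff_add)
      ultimately show ?thesis by metis
    next
      case False
      then have "lt (s + LT \<tau> g) t" using step ord.order_antisym by blast
      then have "Poly_Mapping.single s c * g + (q - ?m d * h) \<in> rep G {s. lt s t}"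
        using step d by (intro rep_add rep_monomial) auto
      then show ?thesis by (intro exI[of _ d]) (simp add: add_diff_eq)
    qed
  qed
  then obtain c where c: "p - ?m c * h \<in> rep G {s. lt s t}" by blast
  \<comment> \<open>The difference lives strictly below \<open>t\<close>; as \<open>p\<close> has no
    term \<open>t\<close> either, the collected multiple of \<open>h\<close> must vanish.\<close>
  then have "Poly_Mapping.lookup (p - ?m c * h) t = 0"
    using rep_keys[OF c G(1), of t] by (auto simp: in_keys_iff)
  then have "c * LC \<tau> h = 0"
    using p(2) h lookup_single_times[of "t - LT \<tau> h" c h "LT \<tau> h"]
    by (simp add: lookup_minus LC_def trm_dvd_diff)
  then have "c = 0" using h0 by simp
  then show ?thesis using c by simp
qed

text \<open>Well-founded descent on the bound \<open>t\<close> of a representation. If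
  \<open>p\<close> has coefficient zero at \<open>t\<close>, then \<open>rep_cancel\<close> lowers
  the bound; otherwise \<open>t\<close> is the leading term of \<open>p\<close>, and some summand
  has to reach it.\<close>

theorem buchberger:
  fixes G :: "('n, 'k::field) mpoly set"
  assumes G: "0 \<notin> G" "\<And>f g. f \<in> G \<Longrightarrow> g \<in> G \<Longrightarrow> spair_ok G f g"
    and p: "p \<in> ideal_gen G" "p \<noteq> 0"
  shows "\<exists>g\<in>G. trm_dvd (LT \<tau> g) (LT \<tau> p)"
proof -
  have "\<exists>g\<in>G. trm_dvd (LT \<tau> g) (LT \<tau> p)" if "p \<in> rep G {s. \<tau> s t}" for t
    using wf_lt that
  proof (induction t rule: wf_induct_rule)
    case (less t)
    have le: "\<tau> s t" if "s \<in> Poly_Mapping.keys p" for s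
      using rep_keys[OF less.prems G(1) that] by (auto intro: ord.order_trans)
    show ?case
    proof (cases "Poly_Mapping.lookup p t = 0")
      case True
      then have "p \<in> rep G {s. lt s t}" using rep_cancel G less.prems by blast
      then obtain t' where "lt t' t" "p \<in> rep G {s. \<tau> s t'}" using rep_bounded p(2) by blast
      then show ?thesis using less.IH by simp
    next
      case False
      then have LT: "LT \<tau> p = t" using le by (intro LT_unique) (auto simp: in_keys_iff)
      show ?thesis
      proof (rule ccontr)
        assume no: "\<not> ?thesis"
        then have "s + LT \<tau> g \<noteq> t" if "g \<in> G" for s g
          using that LT unfolding trm_dvd_def by (metis add.commute)
        then have "{Poly_Mapping.single s 1 * g |s g. g \<in> G \<and> s + LT \<tau> g \<in> {s. \<tau> s t}} \<subseteq>
            {Poly_Mapping.single s (1::'k) * g |s g. g \<in> G \<and> s + LT \<tau> g \<in> {s. lt s t}}"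
          using ord.order_antisym by blast
        then have "p \<in> rep G {s. lt s t}"
          using less.prems mp.span_mono unfolding rep_def by blast
        then show False using rep_keys[OF _ G(1), of p "{s. lt s t}" t] False
          by (auto simp: in_keys_iff)
      qed
    qed
  qed
  moreover obtain t where "p \<in> rep G {s. \<tau> s t}"
    using rep_bounded[of p G UNIV] p by (auto simp: ideal_gen_eq_rep)
  ultimately show ?thesis by blast
qed

lemma groebner_basisI:
  fixes G :: "('n, 'k::field) mpoly set"
  assumes "finite G" "0 \<notin> G"
    and dvd: "\<And>p. p \<in> ideal_gen G \<Longrightarrow> p \<noteq> 0 \<Longrightarrow> \<exists>g\<in>G. trm_dvd (LT \<tau> g) (LT \<tau> p)"
  shows "groebner_basis \<tau> G (ideal_gen G)"
proof -
  let ?M = "\<lambda>A. (\<lambda>t. Poly_Mapping.single t (1::'k)) ` LTs \<tau> A"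
  have sub: "G \<subseteq> ideal_gen G" by (auto simp: ideal_gen_def intro: idl.span_base)
  then have "?M G \<subseteq> ?M (ideal_gen G)" by (auto simp: LTs_def)
  then have "ideal_gen (?M G) \<subseteq> ideal_gen (?M (ideal_gen G))"
    unfolding ideal_gen_def by (rule idl.span_mono)
  moreover have "?M (ideal_gen G) \<subseteq> ideal_gen (?M G)"
  proof
    fix m assume "m \<in> ?M (ideal_gen G)"
    then obtain p where p: "p \<in> ideal_gen G" "p \<noteq> 0" "m = Poly_Mapping.single (LT \<tau> p) 1"
      by (auto simp: LTs_def)
    obtain g where g: "g \<in> G" "trm_dvd (LT \<tau> g) (LT \<tau> p)" using dvd p by blast
    have "m = Poly_Mapping.single (LT \<tau> p - LT \<tau> g) 1 * Poly_Mapping.single (LT \<tau> g) 1"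
      using g p by (simp add: mult_single trm_dvd_diff)
    moreover have "Poly_Mapping.single (LT \<tau> g) 1 \<in> ?M G" using g assms(2) by (auto simp: LTs_def)
    ultimately show "m \<in> ideal_gen (?M G)"
      unfolding ideal_gen_def by (metis idl.span_scale idl.span_base)
  qed
  then have "ideal_gen (?M (ideal_gen G)) \<subseteq> ideal_gen (?M G)"
    unfolding ideal_gen_def by (intro idl.span_minimal idl.subspace_span)
  ultimately show ?thesis using assms(1) sub by (simp add: groebner_basis_def)
qed

end

section \<open>Leading terms of the reduced row echelon form\<close>

lemma lookup_scale:
  fixes f :: "('n, 'k::field) mpoly"
  shows "Poly_Mapping.lookup (Poly_Mapping.single 0 c * f) t = c * Poly_Mapping.lookup f t"
  using lookup_single_times[of 0 c f t] by simp

definition poly_of_vec :: "'n trm list \<Rightarrow> 'k::field vec \<Rightarrow> ('n, 'k) mpoly" where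
  "poly_of_vec ts v = (\<Sum>j<length ts. Poly_Mapping.single (ts ! j) (v $ j))"

lemma lookup_poly_of_vec:
  assumes "distinct ts" "j < length ts"
  shows "Poly_Mapping.lookup (poly_of_vec ts v) (ts ! j) = v $ j"
proof -
  have "Poly_Mapping.lookup (poly_of_vec ts v) (ts ! j) = (\<Sum>i<length ts. if i = j then v $ i else 0)"
    unfolding poly_of_vec_def lookup_sum
    by (intro sum.cong) (use assms in \<open>auto simp: lookup_single when_def nth_eq_iff_index_eq\<close>)
  then show ?thesis using assms by simp
qed

lemma lookup_poly_of_vec_outside:
  "t \<notin> set ts \<Longrightarrow> Poly_Mapping.lookup (poly_of_vec ts v) t = 0"
  unfolding poly_of_vec_def lookup_sum
  by (intro sum.neutral) (auto simp: lookup_single when_def)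

text \<open>The value \<open>m\<close> marks a row without pivot. From row to row the value
  increases strictly or is \<open>m\<close>, so \<open>f r' < m\<close> forces strict increase all
  the way up to \<open>r'\<close>.\<close>

lemma pivot_fun_less:
  assumes "pivot_fun A f m" "r < r'" "r' < dim_row A" "f r' < m"
  shows "f r < f r'"
  using assms(2-4)
proof (induction r')
  case (Suc r')
  have "f r' < f (Suc r') \<or> f (Suc r') = m"
    using pivot_funD(3)[OF refl assms(1), of r'] Suc.prems by simp
  then have "f r' < f (Suc r')" using Suc.prems by simp
  then show ?case using Suc by (cases "r = r'") auto
qed simp

context term_ord
begin

text \<open>Matrix columns are listed by decreasing term; in the dual order they form a strictly
  sorted list, to which the usual facts on existence and uniqueness apply.\<close>

sublocale rev: linorder "\<lambda>s t. \<tau> t s" "\<lambda>s t. lt t s"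
  by (rule ord.dual_linorder)

lemma finite_Supp: "finite (Supp F)"
  by (simp add: Supp_def)

lemma supp_list_props:
  shows set_supp_list: "set (supp_list \<tau> F) = Supp F"
    and sorted_supp_list: "sorted_wrt (\<lambda>s t. lt t s) (supp_list \<tau> F)"
proof -
  have eq: "(\<lambda>s t. \<tau> t s \<and> s \<noteq> t) = (\<lambda>s t. lt t s)"
    using ord.order_antisym by blast
  obtain ts where ts: "sorted_wrt (\<lambda>s t. lt t s) ts" "set ts = Supp F"
    by (rule rev.finite_set_strict_sorted[OF finite_Supp])
  have "supp_list \<tau> F = ts"
    unfolding supp_list_def eq
  proof (rule the_equality)
    fix us assume "set us = Supp F \<and> sorted_wrt (\<lambda>s t. lt t s) us"
    then show "us = ts" using ts by (intro rev.strict_sorted_equal) simp_all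
  qed (use ts in simp)
  then show "set (supp_list \<tau> F) = Supp F" "sorted_wrt (\<lambda>s t. lt t s) (supp_list \<tau> F)"
    using ts by simp_all
qed

lemma distinct_supp_list: "distinct (supp_list \<tau> F)"
  using sorted_supp_list[of F] rev.strict_sorted_iff[of "supp_list \<tau> F"] by simp

lemma supp_list_le:
  assumes "i \<le> j" "j < length (supp_list \<tau> F)"
  shows "\<tau> (supp_list \<tau> F ! j) (supp_list \<tau> F ! i)"
  using sorted_wrt_nth_less[OF sorted_supp_list, of i j F] assms
  by (cases "i = j") auto

text \<open>The echelon form is \<open>P * A\<close> with \<open>P\<close> invertible, so its rows
  and the original ones span the same space. In a combination of echelon rows, the first row taking
  part has the leftmost pivot, and nothing can cancel there, so that pivot is the leading
  term.\<close>

lemma rref_props: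
  fixes F :: "('n, 'k::field) mpoly list"
  shows rref_nonzero: "0 \<notin> set (rref \<tau> F)"
    and rref_in_span: "set (rref \<tau> F) \<subseteq> mp.span (set F)"
    and LT_span_rref: "\<And>v. v \<in> mp.span (set F) \<Longrightarrow> v \<noteq> 0 \<Longrightarrow> \<exists>h\<in>set (rref \<tau> F). LT \<tau> h = LT \<tau> v"
proof -
  define ts where "ts = supp_list \<tau> F"
  define A where "A = poly_matrix \<tau> F"
  define B where "B = gauss_jordan_single A"
  define n m where "n = length F" and "m = length ts"
  define b where "b r = poly_of_vec ts (row B r)" for r
  have dist: "distinct ts" by (simp add: ts_def distinct_supp_list)
  have A: "A \<in> carrier_mat n m" by (simp add: A_def poly_matrix_def n_def m_def ts_def)
  note gj = gauss_jordan_single[OF A B_def[symmetric]]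
  have B: "B \<in> carrier_mat n m" "dim_row B = n" "dim_col B = m" using gj(2) by auto
  obtain P Q where PQ: "B = P * A" "P \<in> carrier_mat n n" "Q \<in> carrier_mat n n" "Q * P = 1\<^sub>m n"
    using gj(4) by blast
  have "Q * B = (Q * P) * A" unfolding PQ(1) by (rule assoc_mult_mat[symmetric]) (use PQ A in auto)
  \<comment> \<open>Used to write the polynomials of \<open>F\<close> through the echelon rows;
    \<open>P\<close> gives the opposite direction.\<close>
  then have QB: "A = Q * B" unfolding PQ(4) using A by simp
  have dims: "dim_row P = n" "dim_col P = n" "dim_row Q = n" "dim_col Q = n" "dim_row A = n" "dim_col A = m"
    using PQ(2,3) A by auto
  obtain f where f: "pivot_fun B f m" using gj(3) B by (auto simp: row_echelon_form_def)
  note piv = pivot_funD[OF B(2) f]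
  have lookup_b: "Poly_Mapping.lookup (b r) (ts ! j) = B $$ (r, j)" if "r < n" "j < m" for r j
    using that B by (simp add: b_def m_def lookup_poly_of_vec[OF dist])
  have b_out: "Poly_Mapping.lookup (b r) t = 0" if "t \<notin> set ts" for r t
    using that by (simp add: b_def lookup_poly_of_vec_outside)
  have lookup_F: "Poly_Mapping.lookup (F ! i) (ts ! j) = A $$ (i, j)" if "i < n" "j < m" for i j
    using that by (simp add: A_def poly_matrix_def n_def m_def ts_def)
  have F_out: "Poly_Mapping.lookup (F ! i) t = 0" if "i < n" "t \<notin> set ts" for i t
    using that set_supp_list[of F] by (auto simp: n_def ts_def Supp_def in_keys_iff)
  have mem_ts: "\<exists>j<m. t = ts ! j" if "t \<in> set ts" for t
    using that by (auto simp: m_def in_set_conv_nth)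
  have rref: "set (rref \<tau> F) = b ` {r. r < n \<and> row B r \<noteq> 0\<^sub>v m}"
  proof -
    have "rref \<tau> F = map (poly_of_vec ts) (filter (\<lambda>r. r \<noteq> 0\<^sub>v m) (rows B))"
      by (simp add: rref_def Let_def poly_of_vec_def[abs_def] ts_def m_def B_def A_def)
    moreover have "set (rows B) = row B ` {..<n}" using B(2) by (simp add: rows_def atLeast0LessThan)
    ultimately show ?thesis unfolding b_def[abs_def] by auto
  qed
  show "0 \<notin> set (rref \<tau> F)"
  proof
    assume "0 \<in> set (rref \<tau> F)"
    then obtain r where r: "r < n" "row B r \<noteq> 0\<^sub>v m" "b r = 0" using rref by auto
    then have "B $$ (r, j) = 0" if "j < m" for j using lookup_b[OF r(1) that] by simp
    then have "row B r = 0\<^sub>v m" using B r(1) by (intro eq_vecI) auto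
    then show False using r(2) by simp
  qed
  show "set (rref \<tau> F) \<subseteq> mp.span (set F)"
  proof -
    have "b r \<in> mp.span (set F)" if r: "r < n" for r
    proof -
      have "b r = (\<Sum>i<n. Poly_Mapping.single 0 (P $$ (r, i)) * F ! i)"
      proof (rule poly_mapping_eqI)
        fix t
        show "Poly_Mapping.lookup (b r) t =
          Poly_Mapping.lookup (\<Sum>i<n. Poly_Mapping.single 0 (P $$ (r, i)) * F ! i) t"
        proof (cases "t \<in> set ts")
          case True
          then obtain j where j: "j < m" "t = ts ! j" using mem_ts by blast
          have "B $$ (r, j) = (\<Sum>i<n. P $$ (r, i) * A $$ (i, j))"
            using PQ(1) dims r j by (simp add: scalar_prod_def atLeast0LessThan)
          then show ?thesis
            using r j by (simp add: lookup_b lookup_F lookup_sum lookup_scale)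
        qed (simp add: lookup_sum lookup_scale b_out F_out)
      qed
      also have "\<dots> \<in> mp.span (set F)"
        by (intro mp.span_sum mp.span_scale mp.span_base) (simp add: n_def)
      finally show ?thesis .
    qed
    then show ?thesis using rref by auto
  qed
  fix v assume v: "v \<in> mp.span (set F)" "v \<noteq> 0"
  have "\<exists>d. \<forall>t. Poly_Mapping.lookup v t = (\<Sum>r<n. d r * Poly_Mapping.lookup (b r) t)"
    using v(1)
  proof (induction rule: mp.span_induct_alt)
    case base
    show ?case by (rule exI[of _ "\<lambda>_. 0"]) simp
  next
    case (step c x y)
    then obtain d where d: "\<And>t. Poly_Mapping.lookup y t = (\<Sum>r<n. d r * Poly_Mapping.lookup (b r) t)"
      by blast
    from step obtain i where i: "i < n" "x = F ! i" by (auto simp: in_set_conv_nth n_def)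
    have x: "Poly_Mapping.lookup x t = (\<Sum>r<n. Q $$ (i, r) * Poly_Mapping.lookup (b r) t)" for t
    proof (cases "t \<in> set ts")
      case True
      then obtain j where j: "j < m" "t = ts ! j" using mem_ts by blast
      have "A $$ (i, j) = (\<Sum>r<n. Q $$ (i, r) * B $$ (r, j))"
        using dims B i(1) j(1) by (subst QB) (simp add: scalar_prod_def atLeast0LessThan)
      then show ?thesis using i j by (simp add: lookup_b lookup_F)
    qed (simp add: i F_out b_out)
    show ?case
      by (rule exI[of _ "\<lambda>r. c * Q $$ (i, r) + d r"])
        (simp add: lookup_add lookup_scale x d distrib_right sum.distrib sum_distrib_left mult.assoc)
  qed
  then obtain d where d: "\<And>t. Poly_Mapping.lookup v t = (\<Sum>r<n. d r * Poly_Mapping.lookup (b r) t)"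
    by blast
  \<comment> \<open>The rows that really contribute to \<open>v\<close>: nonzero coefficient, and a
    pivot, hence not a zero row.\<close>
  define active where "active r \<longleftrightarrow> r < n \<and> d r \<noteq> 0 \<and> f r < m" for r
  have key: "\<exists>r j. active r \<and> f r \<le> j \<and> j < m \<and> t = ts ! j" if t: "t \<in> Poly_Mapping.keys v" for t
  proof -
    have "(\<Sum>r<n. d r * Poly_Mapping.lookup (b r) t) \<noteq> 0" using t d by (simp add: in_keys_iff)
    then obtain r where r: "r < n" "d r * Poly_Mapping.lookup (b r) t \<noteq> 0"
      by (meson lessThan_iff sum.not_neutral_contains_not_neutral)
    then have "t \<in> set ts" using b_out by fastforce
    then obtain j where j: "j < m" "t = ts ! j" using mem_ts by blast
    then have "B $$ (r, j) \<noteq> 0" using r lookup_b by auto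
    then have "f r \<le> j" using piv(2)[OF r(1)] not_less by blast
    then show ?thesis using r j unfolding active_def by auto
  qed
  obtain r0 where "active r0" using key[OF LT_in_keys[OF v(2)]] by blast
  define r where "r = (LEAST r. active r)"
  have r: "active r" unfolding r_def by (rule LeastI) fact
  have first: "f r \<le> f r'" if "active r'" for r'
  proof -
    have "r \<le> r'" unfolding r_def by (rule Least_le) fact
    then show ?thesis
      using pivot_fun_less[OF f, of r r'] that B by (cases "r = r'") (auto simp: active_def)
  qed
  have r': "r < n" "d r \<noteq> 0" "f r < m" using r by (auto simp: active_def)
  \<comment> \<open>A pivot column of the reduced form is zero in all other rows, so
    \<open>d r\<close> alone survives.\<close>
  have "Poly_Mapping.lookup v (ts ! f r) = (\<Sum>r'<n. if r' = r then d r else 0)"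
    unfolding d by (intro sum.cong) (use r' piv in \<open>auto simp: lookup_b\<close>)
  then have "ts ! f r \<in> Poly_Mapping.keys v" using r' by (simp add: in_keys_iff)
  moreover have "\<tau> t (ts ! f r)" if t: "t \<in> Poly_Mapping.keys v" for t
  proof -
    obtain r' j where rj: "active r'" "f r' \<le> j" "j < m" "t = ts ! j" using key[OF t] by blast
    then have "f r \<le> j" using first le_trans by blast
    then show ?thesis using supp_list_le rj by (simp add: ts_def m_def)
  qed
  ultimately have LT_v: "LT \<tau> v = ts ! f r" by (rule LT_unique)
  have piv1: "B $$ (r, f r) = 1" using piv(4) r' by blast
  then have "ts ! f r \<in> Poly_Mapping.keys (b r)" using r' by (simp add: in_keys_iff lookup_b)
  moreover have "\<tau> t (ts ! f r)" if t: "t \<in> Poly_Mapping.keys (b r)" for t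
  proof -
    have "t \<in> set ts" using t b_out by (auto simp: in_keys_iff)
    then obtain j where j: "j < m" "t = ts ! j" using mem_ts by blast
    then have "B $$ (r, j) \<noteq> 0" using t r' by (simp add: lookup_b in_keys_iff)
    then have "f r \<le> j" using piv(2)[OF r'(1)] not_less by blast
    then show ?thesis using supp_list_le j by (simp add: ts_def m_def)
  qed
  ultimately have LT_b: "LT \<tau> (b r) = ts ! f r" by (rule LT_unique)
  have "row B r \<noteq> 0\<^sub>v m"
  proof
    assume "row B r = 0\<^sub>v m"
    then have "row B r $ f r = 0" using r' by simp
    then show False using piv1 r' B by simp
  qed
  then show "\<exists>h\<in>set (rref \<tau> F). LT \<tau> h = LT \<tau> v" using rref r'(1) LT_v LT_b by auto
qed

end

section \<open>Invariant and termination measure of F4\<close>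

text \<open>Supplies the remaining list \<open>P'\<close> required by the rule
  \<open>select\<close>, which therefore cannot get stuck.\<close>

lemma ex_shuffles_subseq: "subseq xs ys \<Longrightarrow> \<exists>zs. ys \<in> shuffles xs zs"
proof (induction rule: list_emb.induct)
  case (list_emb_Nil ys)
  show ?case by (rule exI[of _ ys]) simp
next
  case (list_emb_Cons xs ys y)
  then obtain zs where "ys \<in> shuffles xs zs" by blast
  then show ?case by (intro exI[of _ "y # zs"] Cons_in_shuffles_rightI)
next
  case (list_emb_Cons2 x y xs ys)
  then obtain zs where "ys \<in> shuffles xs zs" by blast
  then show ?case using list_emb_Cons2 by (auto intro: Cons_in_shuffles_leftI)
qed

text \<open>Ensures that the rule \<open>init\<close> can fire: each unordered pair receives an
  orientation by choice.\<close>

lemma all_pairs_exists: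
  fixes G :: "('n, 'k::field) mpoly list"
  shows "\<exists>P. all_pairs \<tau> G P"
proof -
  let ?D = "{{f, g} |f g. f \<in> set G \<and> g \<in> set G \<and> f \<noteq> g}"
  let ?u = "\<lambda>(f, g). {f, g}"
  have "?D \<subseteq> Pow (set G)" by auto
  then have "finite ?D" by (rule finite_subset) simp
  from finite_distinct_list[OF this] obtain ds where ds: "set ds = ?D" "distinct ds" by (elim exE conjE)
  define pr where "pr d = (SOME q. ?u q = d)" for d :: "('n, 'k) mpoly set"
  have pr: "?u (pr d) = d" if d: "d \<in> set ds" for d
  proof -
    obtain f g where "d = {f, g}" using d ds(1) by auto
    then have "?u (f, g) = d" by simp
    then show ?thesis unfolding pr_def by (rule someI)
  qed
  have "map ?u (map pr ds) = ds" unfolding map_map o_def using pr by (rule map_idI)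
  then have "all_pairs \<tau> G (map (\<lambda>(f, g). crit_pair \<tau> f g) (map pr ds))"
    unfolding all_pairs_def using ds by (intro exI[of _ "map pr ds"]) simp
  then show ?thesis by blast
qed

definition pairs_of ::
    "('n trm \<Rightarrow> 'n trm \<Rightarrow> bool) \<Rightarrow> ('n, 'k::field) mpoly set \<Rightarrow> ('n, 'k) cpair set" where
  "pairs_of \<tau> G = {crit_pair \<tau> f g |f g. f \<in> G \<and> g \<in> G}"

lemma pairs_of_mono: "G \<subseteq> H \<Longrightarrow> pairs_of \<tau> G \<subseteq> pairs_of \<tau> H"
  unfolding pairs_of_def by blast

lemma all_pairs_set:
  assumes "all_pairs \<tau> G P"
  shows all_pairs_subset: "set P \<subseteq> pairs_of \<tau> (set G)"
    and all_pairs_complete: "\<And>f g. f \<in> set G \<Longrightarrow> g \<in> set G \<Longrightarrow> f \<noteq> g \<Longrightarrow>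
      crit_pair \<tau> f g \<in> set P \<or> crit_pair \<tau> g f \<in> set P"
proof -
  obtain qs where P: "P = map (\<lambda>(f, g). crit_pair \<tau> f g) qs"
    and qs: "(\<lambda>(f, g). {f, g}) ` set qs = {{f, g} |f g. f \<in> set G \<and> g \<in> set G \<and> f \<noteq> g}"
    using assms unfolding all_pairs_def by auto
  show "set P \<subseteq> pairs_of \<tau> (set G)"
  proof
    fix x assume "x \<in> set P"
    then obtain f g where fg: "(f, g) \<in> set qs" "x = crit_pair \<tau> f g" using P by auto
    then have "{f, g} \<in> {{f, g} |f g. f \<in> set G \<and> g \<in> set G \<and> f \<noteq> g}"
      unfolding qs[symmetric] by force
    then have "f \<in> set G" "g \<in> set G" by (auto simp: doubleton_eq_iff)
    then show "x \<in> pairs_of \<tau> (set G)" using fg by (auto simp: pairs_of_def)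
  qed
  fix f g assume "f \<in> set G" "g \<in> set G" "f \<noteq> g"
  then have "{f, g} \<in> (\<lambda>(f, g). {f, g}) ` set qs" unfolding qs by blast
  then obtain f' g' where "(f', g') \<in> set qs" "{f, g} = {f', g'}" by auto
  then show "crit_pair \<tau> f g \<in> set P \<or> crit_pair \<tau> g f \<in> set P"
    unfolding P by (force simp: doubleton_eq_iff)
qed

text \<open>For the last claim: of two distinct elements not both in \<open>G\<close>, the one
  appended later is paired with the other at that moment, and the fold never removes a pair.\<close>

lemma fold_add_elem:
  assumes "fold (add_elem \<tau>) hs (G, P) = (G', P')"
  shows "G' = G @ hs" "set P \<subseteq> set P'" "set P' \<subseteq> set P \<union> pairs_of \<tau> (set G')" "hs = [] \<Longrightarrow> P' = P"
    and "\<And>f g. f \<in> set G' \<Longrightarrow> g \<in> set G' \<Longrightarrow> f \<noteq> g \<Longrightarrow> f \<in> set G \<and> g \<in> set G \<or>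
      crit_pair \<tau> f g \<in> set P' \<or> crit_pair \<tau> g f \<in> set P'"
proof -
  have "G' = G @ hs \<and> set P \<subseteq> set P' \<and> set P' \<subseteq> set P \<union> pairs_of \<tau> (set G') \<and> (hs = [] \<longrightarrow> P' = P) \<and>
    (\<forall>f\<in>set G'. \<forall>g\<in>set G'. f \<noteq> g \<longrightarrow> f \<in> set G \<and> g \<in> set G \<or>
      crit_pair \<tau> f g \<in> set P' \<or> crit_pair \<tau> g f \<in> set P')"
    using assms
  proof (induction hs arbitrary: G P)
    case (Cons h hs)
    let ?G = "G @ [h]" and ?P = "P @ map (crit_pair \<tau> h) G"
    have "fold (add_elem \<tau>) hs (?G, ?P) = (G', P')" using Cons.prems by simp
    note IH = Cons.IH[OF this]
    then have G': "G' = ?G @ hs" by blast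
    have "set ?P \<subseteq> set P'" using IH by blast
    then have P: "set P \<subseteq> set P'" "\<And>g. g \<in> set G \<Longrightarrow> crit_pair \<tau> h g \<in> set P'" by auto
    have "set ?P \<subseteq> set P \<union> pairs_of \<tau> (set G')" unfolding G' pairs_of_def by auto
    moreover have "set P' \<subseteq> set ?P \<union> pairs_of \<tau> (set G')" using IH by blast
    ultimately have P': "set P' \<subseteq> set P \<union> pairs_of \<tau> (set G')" by blast
    have "f \<in> set G \<and> g \<in> set G \<or> crit_pair \<tau> f g \<in> set P' \<or> crit_pair \<tau> g f \<in> set P'"
      if "f \<in> set G'" "g \<in> set G'" "f \<noteq> g" for f g
    proof -
      have "f \<in> set ?G \<and> g \<in> set ?G \<or> crit_pair \<tau> f g \<in> set P' \<or> crit_pair \<tau> g f \<in> set P'"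
        using IH that by blast
      then show ?thesis using P(2) that(3) by auto
    qed
    then show ?case using G' P(1) P' by simp
  qed auto
  then show "G' = G @ hs" "set P \<subseteq> set P'" "set P' \<subseteq> set P \<union> pairs_of \<tau> (set G')" "hs = [] \<Longrightarrow> P' = P"
    "\<And>f g. f \<in> set G' \<Longrightarrow> g \<in> set G' \<Longrightarrow> f \<noteq> g \<Longrightarrow> f \<in> set G \<and> g \<in> set G \<or>
      crit_pair \<tau> f g \<in> set P' \<or> crit_pair \<tau> g f \<in> set P'"
    by blast+
qed

lemma set_halves: "set (halves P) = (\<Union>(m, p, q)\<in>set P. {p, q})"
  by (auto simp: halves_def)

definition multiples :: "('n, 'k::field) mpoly set \<Rightarrow> ('n, 'k) mpoly set" where
  "multiples G = {Poly_Mapping.single s c * g |s c g. g \<in> G \<and> c \<noteq> 0}"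

context term_ord
begin

lemma LTs_subset_Supp: "LTs \<tau> (set F) \<subseteq> Supp F"
  by (auto simp: LTs_def Supp_def intro: LT_in_keys)

lemma s_half_in_multiples: "f \<in> G \<Longrightarrow> g \<noteq> 0 \<Longrightarrow> s_half \<tau> f g \<in> multiples G"
  unfolding multiples_def s_half_def using LC_nonzero by blast

lemma LT_spoly_less:
  fixes f g :: "('n, 'k::field) mpoly"
  assumes "f \<noteq> 0" "g \<noteq> 0" "s_half \<tau> f g - s_half \<tau> g f \<noteq> 0"
  shows "lt (LT \<tau> (s_half \<tau> f g - s_half \<tau> g f)) (trm_lcm (LT \<tau> f) (LT \<tau> g))"
proof -
  let ?p = "s_half \<tau> f g" and ?q = "s_half \<tau> g f" and ?l = "trm_lcm (LT \<tau> f) (LT \<tau> g)"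
  have nz: "?p \<noteq> 0" "?q \<noteq> 0" using assms s_half_nonzero by blast+
  have LT: "LT \<tau> ?p = ?l" "LT \<tau> ?q = ?l"
    using LT_s_half[OF assms(1,2)] LT_s_half[OF assms(2,1)] by (simp_all add: trm_lcm_commute)
  show ?thesis
  proof (rule LT_lt_if_cancels[OF assms(3)])
    fix s assume "s \<in> Poly_Mapping.keys (?p - ?q)"
    then have "s \<in> Poly_Mapping.keys ?p \<or> s \<in> Poly_Mapping.keys ?q"
      by (auto simp: in_keys_iff lookup_minus)
    then show "\<tau> s ?l" using le_LT[OF nz(1), of s] le_LT[OF nz(2), of s] LT by auto
  next
    show "Poly_Mapping.lookup (?p - ?q) ?l = 0"
      using LC_s_half[OF assms(1,2)] LC_s_half[OF assms(2,1)] unfolding LC_def[of \<tau> "s_half _ _ _"] LT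
      by (simp add: lookup_minus)
  qed
qed

text \<open>Division with remainder inside the row space: from \<open>v\<close> subtract an element
  with the same leading term and a bounded representation. The difference stays in the space and has
  a smaller leading term, so the induction has to range over all \<open>v\<close>.\<close>

lemma span_reduces:
  fixes G :: "('n, 'k::field) mpoly set"
  assumes G: "0 \<notin> G" and F: "set F \<subseteq> multiples G"
    and v: "v \<in> mp.span (set F)" "v \<noteq> 0"
  shows "v \<in> rep (G \<union> set (rref_plus \<tau> F)) {s. \<tau> s (LT \<tau> v)}"
proof -
  let ?H = "G \<union> set (rref_plus \<tau> F)"
  have "\<forall>v. v \<in> mp.span (set F) \<longrightarrow> v \<noteq> 0 \<longrightarrow> LT \<tau> v = t \<longrightarrow> v \<in> rep ?H {s. \<tau> s t}" for t
  proof (induction t rule: wf_induct_rule[OF wf_lt])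
    case (1 t)
    show ?case
    proof (intro allI impI)
      fix v assume v: "v \<in> mp.span (set F)" "v \<noteq> 0" "LT \<tau> v = t"
      obtain h where h: "h \<in> set (rref \<tau> F)" "LT \<tau> h = t" using LT_span_rref v by blast
      \<comment> \<open>If \<open>t\<close> is a leading term of \<open>F\<close>, the row itself
        serves, being a multiple of an element of \<open>G\<close>; otherwise the echelon row
        \<open>h\<close> has been kept by \<open>rref_plus\<close> and serves as a new
        generator.\<close>
      have "\<exists>f\<in>mp.span (set F). f \<noteq> 0 \<and> LT \<tau> f = t \<and> f \<in> rep ?H {s. \<tau> s t}"
      proof (cases "t \<in> LTs \<tau> (set F)")
        case True
        then obtain f where f: "f \<in> set F" "f \<noteq> 0" "LT \<tau> f = t" by (auto simp: LTs_def)
        then obtain s c g where g: "f = Poly_Mapping.single s c * g" "g \<in> G" "c \<noteq> 0"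
          using F by (auto simp: multiples_def)
        have "g \<noteq> 0" using g G by metis
        then have "s + LT \<tau> g = t" using f(3) g LT_single_times by metis
        then have "f \<in> rep ?H {s. \<tau> s t}" using g by (auto intro: rep_monomial)
        then show ?thesis using f mp.span_base by blast
      next
        case False
        then have "h \<in> ?H" using h by (simp add: rref_plus_def)
        then have "Poly_Mapping.single 0 1 * h \<in> rep ?H {s. \<tau> s t}"
          using h by (intro rep_monomial) auto
        moreover have "h \<noteq> 0" "h \<in> mp.span (set F)" using h rref_nonzero[of F] rref_in_span[of F] by auto
        ultimately show ?thesis using h by auto
      qed
      then obtain f where f: "f \<in> mp.span (set F)" "f \<noteq> 0" "LT \<tau> f = t" "f \<in> rep ?H {s. \<tau> s t}"
        by blast
      let ?m = "Poly_Mapping.single 0 (LC \<tau> v / LC \<tau> f) * f"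
      have m: "?m \<in> rep ?H {s. \<tau> s t}" by (rule rep_times[OF f(4)]) simp
      have "v - ?m \<in> rep ?H {s. \<tau> s t}"
      proof (cases "v - ?m = 0")
        case False
        have "lt (LT \<tau> (v - ?m)) t"
        proof (rule LT_lt_if_cancels[OF False])
          fix s assume "s \<in> Poly_Mapping.keys (v - ?m)"
          then have "s \<in> Poly_Mapping.keys v \<or> s \<in> Poly_Mapping.keys f"
            by (auto simp: in_keys_iff lookup_minus lookup_scale)
          then show "\<tau> s t" using le_LT[OF v(2), of s] le_LT[OF f(2), of s] v f by auto
        next
          show "Poly_Mapping.lookup (v - ?m) t = 0"
            using LC_nonzero[OF f(2)] v f by (simp add: lookup_minus lookup_scale LC_def)
        qed
        moreover have "v - ?m \<in> mp.span (set F)" using v f by (intro mp.span_diff mp.span_scale)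
        ultimately have "v - ?m \<in> rep ?H {s. \<tau> s (LT \<tau> (v - ?m))}" using 1 False by blast
        moreover have "{s. \<tau> s (LT \<tau> (v - ?m))} \<subseteq> {s. \<tau> s t}"
          using \<open>lt (LT \<tau> (v - ?m)) t\<close> by (auto intro: ord.order_trans)
        ultimately show ?thesis using rep_mono[OF subset_refl] by blast
      qed (simp add: rep_zero)
      from rep_add[OF this m] show "v \<in> rep ?H {s. \<tau> s t}" by simp
    qed
  qed
  then show ?thesis using v by blast
qed

lemma rref_plus_in_ideal:
  assumes "set F \<subseteq> multiples G"
  shows "set (rref_plus \<tau> F) \<subseteq> ideal_gen G"
proof -
  have "set F \<subseteq> rep G UNIV" using assms by (auto simp: multiples_def intro: rep_monomial)
  then have "mp.span (set F) \<subseteq> rep G UNIV"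
    unfolding rep_def by (intro mp.span_minimal mp.subspace_span)
  then show ?thesis using rref_in_span[of F] by (auto simp: rref_plus_def ideal_gen_eq_rep)
qed

text \<open>\<open>X\<close> is the list being preprocessed: while a pair is being treated, it is remembered only through
  its two halves.\<close>

definition covered ::
    "('n, 'k::field) mpoly set \<Rightarrow> ('n, 'k) cpair set \<Rightarrow> ('n, 'k) mpoly set \<Rightarrow> bool" where
  "covered G P X \<longleftrightarrow> (\<forall>f\<in>G. \<forall>g\<in>G. spair_ok G f g \<or> crit_pair \<tau> f g \<in> P \<or> crit_pair \<tau> g f \<in> P \<or>
     s_half \<tau> f g \<in> X \<and> s_half \<tau> g f \<in> X)"

definition basis_inv ::
    "('n, 'k::field) mpoly list \<Rightarrow> ('n, 'k) mpoly list \<Rightarrow> ('n, 'k) cpair list \<Rightarrow> bool" where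
  "basis_inv F\<^sub>0 G P \<longleftrightarrow> set F\<^sub>0 \<subseteq> set G \<and> 0 \<notin> set G \<and> ideal_gen (set G) = ideal_gen (set F\<^sub>0) \<and>
     set P \<subseteq> pairs_of \<tau> (set G)"

text \<open>The clause on \<open>Done\<close> says that a processed term is a leading term of a row
  or lies outside the monomial ideal of \<open>G\<close>; it drives termination. The inclusion in
  \<open>Supp F\<close> guarantees an unprocessed term whenever the preprocessing loop has not
  finished.\<close>

fun f4_inv ::
    "('n, 'k::field) mpoly list \<Rightarrow> ('n trm, ('n, 'k) mpoly) f4_state \<Rightarrow> bool" where
  "f4_inv F\<^sub>0 (Start F) \<longleftrightarrow> F = F\<^sub>0 \<and> 0 \<notin> set F"
| "f4_inv F\<^sub>0 (Loop G P) \<longleftrightarrow> basis_inv F\<^sub>0 G P \<and> covered (set G) (set P) {}"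
| "f4_inv F\<^sub>0 (SymPre G P F Done) \<longleftrightarrow> basis_inv F\<^sub>0 G P \<and> covered (set G) (set P) (set F) \<and>
     set F \<subseteq> multiples (set G) \<and> Done \<subseteq> Supp F \<and>
     (\<forall>t\<in>Done. t \<in> LTs \<tau> (set F) \<or> \<not> (\<exists>g\<in>set G. trm_dvd (LT \<tau> g) t))"

text \<open>The terms of the monomial ideal generated by the leading terms of
  \<open>G\<close>.\<close>

definition upset :: "('n, 'k::field) mpoly list \<Rightarrow> 'n trm set" where
  "upset G = {t. \<exists>g\<in>set G. trm_dvd (LT \<tau> g) t}"

text \<open>Appending elements may lengthen \<open>P\<close> but enlarges \<open>upset G\<close>,
  which therefore comes first. Selecting shortens \<open>P\<close> while setting the third component
  to 1; an update that appends nothing only resets it to 0. The value at \<open>Start\<close> is a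
  placeholder that is never compared.\<close>

fun f4_measure ::
    "('n trm, ('n, 'k::field) mpoly) f4_state \<Rightarrow> 'n trm set \<times> nat \<times> nat \<times> 'n trm multiset" where
  "f4_measure (Start F) = ({}, 0, 0, {#})"
| "f4_measure (Loop G P) = (upset G, length P, 0, {#})"
| "f4_measure (SymPre G P F Done) = (upset G, length P, 1, mset_set (Supp F - Done))"

definition f4_order ::
    "(('n trm set \<times> nat \<times> nat \<times> 'n trm multiset) \<times> 'n trm set \<times> nat \<times> nat \<times> 'n trm multiset) set" where
  "f4_order = {(B, A). A \<subset> B \<and> (\<forall>s t. s \<in> A \<longrightarrow> trm_dvd s t \<longrightarrow> t \<in> A)} <*lex*>
     less_than <*lex*> less_than <*lex*> Multiset.mult {(s, t). lt s t}"

lemma wf_f4_order: "wf f4_order"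
  unfolding f4_order_def
  by (intro wf_lex_prod wf_upset_growth wf_less_than wf_mult wf_lt)

section \<open>Preservation of the invariant\<close>

lemma inv_init:
  fixes F :: "('n, 'k::field) mpoly list"
  assumes "all_pairs \<tau> F P" "0 \<notin> set F"
  shows "f4_inv F (Loop F P)"
proof -
  have "spair_ok (set F) f g \<or> crit_pair \<tau> f g \<in> set P \<or> crit_pair \<tau> g f \<in> set P"
    if "f \<in> set F" "g \<in> set F" for f g
    using all_pairs_complete[OF assms(1) that] spair_ok_self[of "set F" f] by metis
  then show ?thesis
    using all_pairs_subset[OF assms(1)] assms(2) by (simp add: basis_inv_def covered_def)
qed

lemma inv_select:
  fixes P :: "('n, 'k::field) cpair list"
  assumes inv: "f4_inv F\<^sub>0 (Loop G P)" and P: "P \<in> shuffles S P'"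
  shows "f4_inv F\<^sub>0 (SymPre G P' (halves S) (LTs \<tau> (set (halves S))))"
proof -
  have set_P: "set P = set S \<union> set P'" using P by (rule set_shuffles)
  have G: "0 \<notin> set G" "set P \<subseteq> pairs_of \<tau> (set G)" using inv by (auto simp: basis_inv_def)
  have "basis_inv F\<^sub>0 G P'" using inv set_P by (auto simp: basis_inv_def)
  moreover have "covered (set G) (set P') (set (halves S))"
    unfolding covered_def
  proof (intro ballI)
    fix f g assume fg: "f \<in> set G" "g \<in> set G"
    \<comment> \<open>Both orientations of a critical pair yield the same two halves, so it does not
      matter which one was listed.\<close>
    have "s_half \<tau> f g \<in> set (halves S) \<and> s_half \<tau> g f \<in> set (halves S)"
      if "crit_pair \<tau> f g \<in> set S \<or> crit_pair \<tau> g f \<in> set S"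
      using that unfolding set_halves crit_pair_def by force
    then show "spair_ok (set G) f g \<or> crit_pair \<tau> f g \<in> set P' \<or> crit_pair \<tau> g f \<in> set P' \<or>
        s_half \<tau> f g \<in> set (halves S) \<and> s_half \<tau> g f \<in> set (halves S)"
      using inv fg unfolding f4_inv.simps covered_def set_P by blast
  qed
  moreover have "set (halves S) \<subseteq> multiples (set G)"
  proof
    fix x assume "x \<in> set (halves S)"
    then obtain m p q where S: "(m, p, q) \<in> set S" "x = p \<or> x = q" unfolding set_halves by auto
    then have "(m, p, q) \<in> pairs_of \<tau> (set G)" using set_P G by blast
    then obtain f g where fg: "f \<in> set G" "g \<in> set G" "p = s_half \<tau> f g" "q = s_half \<tau> g f"
      by (auto simp: pairs_of_def crit_pair_def)
    then have "f \<noteq> 0" "g \<noteq> 0" using G(1) by metis+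
    then show "x \<in> multiples (set G)" using S(2) fg s_half_in_multiples by blast
  qed
  ultimately show ?thesis using LTs_subset_Supp by simp
qed

lemma LTs_append: "LTs \<tau> (set F) \<subseteq> LTs \<tau> (set (F @ F'))"
  by (auto simp: LTs_def)

text \<open>An appended multiple has exactly the selected term \<open>t\<close> as leading term,
  which gives the first alternative of the clause on \<open>Done\<close>; skipping gives the
  second.\<close>

lemma inv_preprocess:
  fixes F :: "('n, 'k::field) mpoly list"
  assumes inv: "f4_inv F\<^sub>0 (SymPre G P F Done)" and step: "symPre_step \<tau> G (F, Done) (F', Done')"
  shows "f4_inv F\<^sub>0 (SymPre G P F' Done')"
  using step
proof cases
  case (append t g t')
  have "g \<noteq> 0" using inv append by (auto simp: basis_inv_def)
  let ?m = "Poly_Mapping.single t' 1 * g"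
  have LT_m: "LT \<tau> ?m = t" "?m \<noteq> 0"
    using LT_single_times[OF _ \<open>g \<noteq> 0\<close>, of 1 t'] single_times_nonzero[OF _ \<open>g \<noteq> 0\<close>, of 1 t'] append
    by auto
  then have "t \<in> LTs \<tau> (set F')" unfolding append LTs_def by force
  moreover have "LTs \<tau> (set F) \<subseteq> LTs \<tau> (set F')" unfolding append by (rule LTs_append)
  moreover have "covered (set G) (set P) (set F')"
    using inv unfolding append f4_inv.simps covered_def by auto
  moreover have "Supp F \<subseteq> Supp F'" unfolding append by (auto simp: Supp_def)
  moreover have "?m \<in> multiples (set G)" using append unfolding multiples_def by force
  then have "set F' \<subseteq> multiples (set G)" using inv append by simp
  ultimately show ?thesis using inv append by auto
next
  case (skip t)
  have "\<not> (\<exists>g\<in>set G. trm_dvd (LT \<tau> g) t)"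
    using skip unfolding trm_dvd_def by (metis add.commute)
  then show ?thesis using inv skip by simp
qed

text \<open>A pair remembered through its halves has its S-polynomial in the row space. By
  \<open>span_reduces\<close> that has a representation bounded by its own leading term, which lies
  strictly below the lcm; hence the pair is settled. Pairs involving a new element are on the
  list.\<close>

lemma inv_update:
  fixes F :: "('n, 'k::field) mpoly list"
  assumes inv: "f4_inv F\<^sub>0 (SymPre G P F Done)"
    and upd: "fold (add_elem \<tau>) (rref_plus \<tau> F) (G, P) = (G', P')"
  shows "f4_inv F\<^sub>0 (Loop G' P')"
proof -
  note fold = fold_add_elem[OF upd]
  have G: "0 \<notin> set G" "set F\<^sub>0 \<subseteq> set G" "ideal_gen (set G) = ideal_gen (set F\<^sub>0)"
    "set P \<subseteq> pairs_of \<tau> (set G)" "set F \<subseteq> multiples (set G)"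
    using inv by (auto simp: basis_inv_def)
  have G': "set G' = set G \<union> set (rref_plus \<tau> F)" using fold(1) by simp
  have "ideal_gen (set G') = ideal_gen (set G)"
  proof
    have "set G' \<subseteq> ideal_gen (set G)"
      using rref_plus_in_ideal[OF G(5)] idl.span_superset unfolding G' ideal_gen_def by blast
    then show "ideal_gen (set G') \<subseteq> ideal_gen (set G)"
      unfolding ideal_gen_def by (intro idl.span_minimal idl.subspace_span)
    show "ideal_gen (set G) \<subseteq> ideal_gen (set G')"
      unfolding ideal_gen_def G' by (intro idl.span_mono) blast
  qed
  moreover have "0 \<notin> set G'" using G(1) rref_nonzero[of F] by (auto simp: G' rref_plus_def)
  moreover have "set P' \<subseteq> pairs_of \<tau> (set G')"
    using fold(3) G(4) pairs_of_mono[of "set G" "set G'" \<tau>] G' by blast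
  moreover have "covered (set G') (set P') {}"
    unfolding covered_def
  proof (intro ballI)
    fix f g assume fg: "f \<in> set G'" "g \<in> set G'"
    have "spair_ok (set G') f g \<or> crit_pair \<tau> f g \<in> set P' \<or> crit_pair \<tau> g f \<in> set P'"
      if fg: "f \<in> set G" "g \<in> set G"
    proof -
      have "f \<noteq> 0" "g \<noteq> 0" using fg G(1) by metis+
      have "spair_ok (set G') f g" if h: "s_half \<tau> f g \<in> set F" "s_half \<tau> g f \<in> set F"
      proof (cases "s_half \<tau> f g - s_half \<tau> g f = 0")
        case False
        let ?v = "s_half \<tau> f g - s_half \<tau> g f"
        have "?v \<in> mp.span (set F)" using h by (intro mp.span_diff mp.span_base)
        then have "?v \<in> rep (set G') {s. \<tau> s (LT \<tau> ?v)}"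
          using span_reduces[OF G(1,5)] False unfolding G' by blast
        moreover have "lt (LT \<tau> ?v) (trm_lcm (LT \<tau> f) (LT \<tau> g))"
          using LT_spoly_less \<open>f \<noteq> 0\<close> \<open>g \<noteq> 0\<close> False by blast
        then have "{s. \<tau> s (LT \<tau> ?v)} \<subseteq> {s. lt s (trm_lcm (LT \<tau> f) (LT \<tau> g))}"
          using ord.le_less_trans by blast
        ultimately show ?thesis
          unfolding spair_ok_def using rep_mono[OF subset_refl] by blast
      qed (simp add: spair_ok_def rep_zero)
      moreover have "spair_ok (set G) f g \<Longrightarrow> spair_ok (set G') f g"
        unfolding G' by (erule spair_ok_mono) (rule Un_upper1)
      moreover have "covered (set G) (set P) (set F)" using inv by simp
      ultimately show ?thesis using fg fold(2) unfolding covered_def by blast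
    qed
    then show "spair_ok (set G') f g \<or> crit_pair \<tau> f g \<in> set P' \<or> crit_pair \<tau> g f \<in> set P' \<or>
        s_half \<tau> f g \<in> {} \<and> s_half \<tau> g f \<in> {}"
      using fold(5)[OF fg] spair_ok_self by (cases "f = g") auto
  qed
  ultimately show ?thesis using G unfolding f4_inv.simps basis_inv_def G' by blast
qed

section \<open>Decrease of the measure\<close>

lemma measure_preprocess:
  fixes F :: "('n, 'k::field) mpoly list"
  assumes inv: "f4_inv F\<^sub>0 (SymPre G P F Done)" and step: "symPre_step \<tau> G (F, Done) (F', Done')"
  shows "(mset_set (Supp F' - Done'), mset_set (Supp F - Done)) \<in> Multiset.mult {(s, t). lt s t}"
proof -
  let ?X = "Supp F - Done" and ?Y = "Supp F' - Done'"
  have fin: "finite ?X" "finite ?Y" using finite_Supp by blast+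
  \<comment> \<open>The processed term \<open>t\<close> leaves the unprocessed set; since it is the
    leading term of the appended multiple, whatever enters is strictly smaller.\<close>
  obtain t where t: "t \<in> ?X" "t \<notin> ?Y" "\<And>s. s \<in> ?Y \<Longrightarrow> s \<notin> ?X \<Longrightarrow> lt s t"
    using step
  proof cases
    case (append t g t')
    have "g \<noteq> 0" using inv append by (auto simp: basis_inv_def)
    have "lt s t" if s: "s \<in> ?Y" "s \<notin> ?X" for s
    proof -
      have "s \<in> Poly_Mapping.keys (Poly_Mapping.single t' 1 * g)" "s \<noteq> t"
        using s unfolding append by (auto simp: Supp_def)
      then obtain u where "u \<in> Poly_Mapping.keys g" "s = t' + u" by (auto simp: keys_single_times)
      then have "\<tau> s t" using append le_add le_LT[OF \<open>g \<noteq> 0\<close>] by simp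
      then show ?thesis using \<open>s \<noteq> t\<close> ord.order_antisym by blast
    qed
    then show ?thesis using that append by blast
  next
    case (skip t)
    then show ?thesis using that by blast
  qed
  \<comment> \<open>One step of the multiset order: the common part stays, and every element of
    \<open>?Y - ?X\<close> is dominated by \<open>t\<close> in \<open>?X - ?Y\<close>.\<close>
  have "(mset_set (?Y \<inter> ?X) + mset_set (?Y - ?X), mset_set (?Y \<inter> ?X) + mset_set (?X - ?Y))
      \<in> Multiset.mult {(s, t). lt s t}"
    using t fin by (intro one_step_implies_mult) (auto simp: mset_set_empty_iff)
  moreover have "mset_set ?Y = mset_set (?Y \<inter> ?X) + mset_set (?Y - ?X)"
    using fin by (subst mset_set_Union[symmetric]) (auto intro: arg_cong[of _ _ mset_set])
  moreover have "mset_set ?X = mset_set (?Y \<inter> ?X) + mset_set (?X - ?Y)"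
    using fin by (subst mset_set_Union[symmetric]) (auto intro: arg_cong[of _ _ mset_set])
  ultimately show ?thesis by simp
qed

lemma measure_update:
  fixes F :: "('n, 'k::field) mpoly list"
  assumes inv: "f4_inv F\<^sub>0 (SymPre G P F Done)" and Done: "Supp F = Done"
    and upd: "fold (add_elem \<tau>) (rref_plus \<tau> F) (G, P) = (G', P')"
  shows "(f4_measure (Loop G' P'), f4_measure (SymPre G P F Done)) \<in> f4_order"
proof (cases "rref_plus \<tau> F")
  case Nil
  then show ?thesis using upd by (simp add: f4_order_def)
next
  case (Cons h hs)
  then have "h \<in> set (rref_plus \<tau> F)" by simp
  then have h: "h \<in> set (rref \<tau> F)" "LT \<tau> h \<notin> LTs \<tau> (set F)" and hG': "h \<in> set G'"
    using fold_add_elem(1)[OF upd] by (simp_all add: rref_plus_def)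
  have "h \<noteq> 0" using h(1) rref_nonzero[of F] by metis
  have "LT \<tau> h \<in> Supp F"
  proof -
    have "Poly_Mapping.keys p \<subseteq> Supp F" if "p \<in> mp.span (set F)" for p
      using that
    proof (induction rule: mp.span_induct_alt)
      case (step c x y)
      have "Poly_Mapping.keys (Poly_Mapping.single 0 c * x) \<subseteq> Poly_Mapping.keys x"
        by (auto simp: in_keys_iff lookup_scale)
      moreover have "Poly_Mapping.keys x \<subseteq> Supp F" using step by (auto simp: Supp_def)
      ultimately show ?case
        using keys_add[of "Poly_Mapping.single 0 c * x" y] step by blast
    qed simp
    from this[of h] show ?thesis using h(1) rref_in_span[of F] LT_in_keys[OF \<open>h \<noteq> 0\<close>] by blast
  qed
  \<comment> \<open>At the exit \<open>Supp F = Done\<close>, so the clause on \<open>Done\<close>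
    applies to this term, and \<open>h(2)\<close> excludes its first alternative.\<close>
  then have "LT \<tau> h \<notin> upset G" using inv h(2) Done by (auto simp: upset_def)
  moreover have "LT \<tau> h \<in> upset G'"
    using hG' by (auto simp: upset_def trm_dvd_iff)
  moreover have "upset G \<subseteq> upset G'"
    using fold_add_elem(1)[OF upd] by (auto simp: upset_def)
  moreover have "\<forall>s t. s \<in> upset G \<longrightarrow> trm_dvd s t \<longrightarrow> t \<in> upset G"
    unfolding upset_def using trm_dvd_trans by blast
  ultimately have "upset G \<subset> upset G' \<and> (\<forall>s t. s \<in> upset G \<longrightarrow> trm_dvd s t \<longrightarrow> t \<in> upset G)"
    by blast
  then show ?thesis by (simp add: f4_order_def)
qed

text \<open>A selection function is constrained only on lists of critical pairs of nonzero
  polynomials; the invariant shows that \<open>P\<close> is such a list.\<close>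

lemma selection:
  assumes "selection_function \<tau> Sel" "f4_inv F\<^sub>0 (Loop G P)"
  shows "subseq (Sel P) P" "P \<noteq> [] \<Longrightarrow> Sel P \<noteq> []"
proof -
  have "set P \<subseteq> {crit_pair \<tau> f g |f g. f \<noteq> 0 \<and> g \<noteq> 0}"
  proof
    fix x assume "x \<in> set P"
    then obtain f g where "x = crit_pair \<tau> f g" "f \<in> set G" "g \<in> set G"
      using assms(2) by (auto simp: basis_inv_def pairs_of_def)
    moreover from this have "f \<noteq> 0" "g \<noteq> 0" using assms(2) by (auto simp: basis_inv_def)
    ultimately show "x \<in> {crit_pair \<tau> f g |f g. f \<noteq> 0 \<and> g \<noteq> 0}" by blast
  qed
  then show "subseq (Sel P) P" "P \<noteq> [] \<Longrightarrow> Sel P \<noteq> []"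
    using assms(1) by (auto simp: selection_function_def)
qed

lemma step_inv:
  assumes "f4_step \<tau> Sel s s'" "f4_inv F\<^sub>0 s"
  shows "f4_inv F\<^sub>0 s'"
  using assms
proof cases
  case (init F P)
  then show ?thesis using inv_init[of F P] assms(2) by auto
next
  case (select P P' L G)
  then show ?thesis using inv_select assms(2) by blast
next
  case (preprocess F Done G F' Done' P)
  then show ?thesis using inv_preprocess assms(2) by blast
next
  case (update F Done G' P' G P)
  then show ?thesis using inv_update[of F\<^sub>0 G P F Done G' P'] assms(2) by simp
qed

lemma step_measure:
  assumes "f4_step \<tau> Sel s s'" "f4_inv F\<^sub>0 s" "\<And>F. s \<noteq> Start F" "selection_function \<tau> Sel"
  shows "(f4_measure s', f4_measure s) \<in> f4_order"
  using assms(1)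
proof cases
  case (init F P)
  then show ?thesis using assms(3) by blast
next
  case (select P P' L G)
  then have "length P = length (Sel P) + length P'" using length_shuffles by blast
  moreover have "Sel P \<noteq> []" using selection(2)[OF assms(4)] assms(2) select by blast
  ultimately show ?thesis using select by (simp add: f4_order_def)
next
  case (preprocess F Done G F' Done' P)
  then show ?thesis using measure_preprocess assms(2) by (simp add: f4_order_def)
next
  case (update F Done G' P' G P)
  then show ?thesis using measure_update[of F\<^sub>0 G P F Done G' P'] assms(2) by simp
qed

lemma step_progress:
  assumes "f4_inv F\<^sub>0 s" "selection_function \<tau> Sel" "\<And>s'. \<not> f4_step \<tau> Sel s s'"
  shows "\<exists>G. s = Loop G []"
proof (cases s)
  case (Start F)
  then show ?thesis using all_pairs_exists[of \<tau> F] f4_step.init assms(3) by blast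
next
  case (Loop G P)
  have "P = []"
  proof (rule ccontr)
    assume "P \<noteq> []"
    obtain P' where "P \<in> shuffles (Sel P) P'"
      using ex_shuffles_subseq selection(1)[OF assms(2)] assms(1) Loop by blast
    then show False using f4_step.select[OF \<open>P \<noteq> []\<close>] assms(3) Loop by blast
  qed
  then show ?thesis using Loop by blast
next
  case (SymPre G P F Done)
  show ?thesis
  proof (cases "Supp F = Done")
    case True
    then show ?thesis
      using f4_step.update[OF True] assms(3) SymPre by (metis surj_pair)
  next
    case False
    then obtain t where t: "t \<in> Supp F - Done" using assms(1) SymPre by auto
    have "\<exists>F' Done'. symPre_step \<tau> G (F, Done) (F', Done')"
    proof (cases "\<exists>g\<in>set G. \<exists>t'. t = t' + LT \<tau> g")
      case True
      then show ?thesis using symPre_step.append[OF t] by blast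
    next
      case False
      then show ?thesis using symPre_step.skip[OF t] by blast
    qed
    then show ?thesis using f4_step.preprocess[OF False] assms(3) SymPre by blast
  qed
qed

end

theorem theorem3p13:
  fixes \<tau> :: "'n::finite trm \<Rightarrow> 'n trm \<Rightarrow> bool"
    and F :: "('n, 'k::field) mpoly list"
    and Sel :: "('n, 'k) cpair list \<Rightarrow> ('n, 'k) cpair list"
  assumes "term_order \<tau>"
    and "0 \<notin> set F"
    and "selection_function \<tau> Sel"
  shows "f4_terminates_with \<tau> Sel F
    (\<lambda>G. groebner_basis \<tau> (set G) (ideal_gen (set F)) \<and>
         set F \<subseteq> set G \<and>
         ideal_gen (set F) = ideal_gen (set G))"
proof -
  interpret term_ord \<tau> by unfold_locales (rule assms(1))
  have start: "f4_inv F (Start F)" using assms(2) by simp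
  have no_start: "s' \<noteq> Start F'" if "f4_step \<tau> Sel s s'" for s s' F'
    using that by cases auto
  have "False" if \<sigma>: "\<sigma> 0 = Start F" "\<forall>i::nat. f4_step \<tau> Sel (\<sigma> i) (\<sigma> (Suc i))" for \<sigma>
  proof -
    have inv: "f4_inv F (\<sigma> i)" for i
    proof (induction i)
      case 0
      show ?case using \<sigma>(1) start by simp
    next
      case (Suc i)
      then show ?case using step_inv \<sigma>(2) by blast
    qed
    \<comment> \<open>The run is shifted by one because the measure has no meaning at
      \<open>Start\<close>, a state that no step enters.\<close>
    have "(f4_measure (\<sigma> (Suc (Suc i))), f4_measure (\<sigma> (Suc i))) \<in> f4_order" for i
      using step_measure[OF _ inv _ assms(3)] \<sigma>(2) no_start by blast
    then have "\<exists>f. \<forall>i. (f (Suc i), f i) \<in> f4_order"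
      by (intro exI[of _ "\<lambda>i. f4_measure (\<sigma> (Suc i))"]) blast
    then show False using wf_f4_order unfolding wf_iff_no_infinite_down_chain by blast
  qed
  moreover have "\<exists>G. s = Loop G [] \<and> groebner_basis \<tau> (set G) (ideal_gen (set F)) \<and>
      set F \<subseteq> set G \<and> ideal_gen (set F) = ideal_gen (set G)"
    if s: "(f4_step \<tau> Sel)\<^sup>*\<^sup>* (Start F) s" "\<not> (\<exists>s'. f4_step \<tau> Sel s s')" for s
  proof -
    have inv: "f4_inv F s" using s(1) start by (induction rule: rtranclp_induct) (auto intro: step_inv)
    then obtain G where G: "s = Loop G []" using step_progress assms(3) s(2) by blast
    \<comment> \<open>With no pairs and no rows left, \<open>covered\<close> reduces to
      \<open>spair_ok\<close> for all elements of \<open>G\<close>.\<close>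
    then have basis: "0 \<notin> set G" "set F \<subseteq> set G" "ideal_gen (set G) = ideal_gen (set F)"
      and "\<And>f g. f \<in> set G \<Longrightarrow> g \<in> set G \<Longrightarrow> spair_ok (set G) f g"
      using inv by (auto simp: basis_inv_def covered_def)
    then have "groebner_basis \<tau> (set G) (ideal_gen (set G))"
      by (intro groebner_basisI buchberger) simp_all
    then show ?thesis using G basis by simp
  qed
  ultimately show ?thesis unfolding f4_terminates_with_def by blast
qed

end
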